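(* Let $k,n\ge1$, $m=kn-1$, and let $g$ be the metric on $\mathbb P_m\mathbb C$ described in the context with $a_m=m+1$, $dv$ its volume element. For every $\alpha<1$ there exists a constant $C$ such that $$\int_{\mathbb P_m\mathbb C}e^{-\alpha\varphi}\,dv\le C$$ for every $\varphi\in C^\infty(\mathbb P_m\mathbb C)$ that is $g$-admissible, $G_{n,k}$-invariant, and satisfies $\sup_{\mathbb P_m\mathbb C}\varphi=0$.
   Context: Homogeneous coordinates on $\mathbb P_m\mathbb C$, $m=kn-1$, are written $[z_0,\dots,z_m]=[Z_0,\dots,Z_{k-1}]$ with blocks $Z_h=(z_{hn},\dots,z_{(h+1)n-1})\in\mathbb C^n$. The metric $g$ is $a_m$ times the Fubini–Study metric: in the chart $\{z_0=1\}$ its components are $g_{\lambda\bar\mu}=a_m\,\partial^2\ln(1+|z_1|^2+\cdots+|z_m|^2)/\partial z_\lambda\partial\bar z_\mu$. A function $\varphi\in C^\infty(\mathbb P_m\mathbb C)$ is $g$-admissible if $g_{\lambda\bar\mu}+\partial^2\varphi/\partial z_\lambda\partial\bar z_\mu$ is positive definite everywhere. $G_{n,k}$ is the group of automorphisms of $\mathbb P_m\mathbb C$ generated by: swaps of two blocks $Z_i,Z_j$; multiplication of a single homogeneous coordinate $z_p$ by $e^{i\theta}$; and transpositions of two coordinates $z_p,z_q$ lying in the same block $Z_h$. *)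

theory Defs
  imports "HOL-Analysis.Analysis"
begin

text \<open>Homogeneous coordinates on P_m(C), m = kn - 1, are vectors
  Z :: complex^('k \<times> 'n); the coordinate z_{hn+i} is Z $ (h,i), so the
  block Z_h is (Z $ (h,i))_i.  Functions on P_m(C) are represented by their
  lifts to C^{m+1} - {0}, i.e. functions invariant under Z \<mapsto> c Z, c \<noteq> 0.\<close>

type_synonym ('k,'n) hcoord = "complex ^ ('k \<times> 'n)"

fun Ck :: "nat \<Rightarrow> 'a::real_normed_vector set \<Rightarrow> ('a \<Rightarrow> real) \<Rightarrow> bool" where
  "Ck 0 S f = continuous_on S f"
| "Ck (Suc k) S f = ((\<forall>x\<in>S. f differentiable (at x)) \<and>
      (\<forall>v. Ck k S (\<lambda>x. frechet_derivative f (at x) v)))"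

definition smooth_on :: "'a::real_normed_vector set \<Rightarrow> ('a \<Rightarrow> real) \<Rightarrow> bool" where
  "smooth_on S f \<longleftrightarrow> (\<forall>k. Ck k S f)"

definition proj_fun :: "(('k::finite,'n::finite) hcoord \<Rightarrow> real) \<Rightarrow> bool" where
  "proj_fun f \<longleftrightarrow> (\<forall>Z (c::complex). Z \<noteq> 0 \<and> c \<noteq> 0 \<longrightarrow> f (\<chi> q. c * Z $ q) = f Z)"

definition smooth_proj :: "(('k::finite,'n::finite) hcoord \<Rightarrow> real) \<Rightarrow> bool" where
  "smooth_proj f \<longleftrightarrow> proj_fun f \<and> smooth_on (- {0}) f"

definition D2 :: "('a::real_normed_vector \<Rightarrow> real) \<Rightarrow> 'a \<Rightarrow> 'a \<Rightarrow> 'a \<Rightarrow> real" where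
  "D2 F Z a b = frechet_derivative (\<lambda>Y. frechet_derivative F (at Y) a) (at Z) b"

text \<open>Wirtinger second derivative d^2 F / dz_l d(conj z_m), written out as
  (1/4)(d_{x_l} - i d_{y_l})(d_{x_m} + i d_{y_m}) F.\<close>
definition wirt2 :: "(complex ^ 'i \<Rightarrow> real) \<Rightarrow> complex ^ 'i \<Rightarrow> 'i::finite \<Rightarrow> 'i \<Rightarrow> complex" where
  "wirt2 F Z l m = (1/4) *
     (complex_of_real (D2 F Z (axis l 1) (axis m 1))
      + \<i> * complex_of_real (D2 F Z (axis l 1) (axis m \<i>))
      - \<i> * complex_of_real (D2 F Z (axis l \<i>) (axis m 1))
      + complex_of_real (D2 F Z (axis l \<i>) (axis m \<i>)))"

text \<open>a_m log |Z|^2: restricted to the affine chart {z_j = 1} this is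
  a_m log(1 + sum_{i \<noteq> j} |w_i|^2), the Kaehler potential of g.\<close>
definition fs_pot :: "real \<Rightarrow> complex ^ 'i \<Rightarrow> real" where
  "fs_pot a Z = a * ln ((norm Z)\<^sup>2)"

text \<open>g-admissibility: in every affine chart {z_j = 1} (coordinates z_i, i \<noteq> j),
  the Hermitian matrix g_{l m} + d^2 phi/dz_l d(conj z_m) is positive definite.
  Since the chart is an affine subspace, these are the Wirtinger derivatives of
  the lift in directions with j-th component 0.\<close>
definition admissible :: "real \<Rightarrow> (complex ^ 'i::finite \<Rightarrow> real) \<Rightarrow> bool" where
  "admissible a phi \<longleftrightarrow>
     (\<forall>j Z u. Z $ j = 1 \<and> u \<noteq> 0 \<and> u $ j = 0 \<longrightarrow>
        Re (\<Sum>l\<in>UNIV. \<Sum>m\<in>UNIV.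
              (wirt2 (fs_pot a) Z l m + wirt2 phi Z l m) * u $ l * cnj (u $ m)) > 0)"

definition swp :: "'a \<Rightarrow> 'a \<Rightarrow> 'a \<Rightarrow> 'a" where
  "swp p q r = (if r = p then q else if r = q then p else r)"

definition block_swap :: "'k \<Rightarrow> 'k \<Rightarrow> ('k::finite,'n::finite) hcoord \<Rightarrow> ('k,'n) hcoord" where
  "block_swap h h' Z = (\<chi> q. Z $ (swp h h' (fst q), snd q))"

definition phase :: "'k \<times> 'n \<Rightarrow> real \<Rightarrow> ('k::finite,'n::finite) hcoord \<Rightarrow> ('k,'n) hcoord" where
  "phase p \<theta> Z = (\<chi> q. if q = p then exp (\<i> * complex_of_real \<theta>) * Z $ q else Z $ q)"

definition in_block_swap :: "'k \<Rightarrow> 'n \<Rightarrow> 'n \<Rightarrow> ('k::finite,'n::finite) hcoord \<Rightarrow> ('k,'n) hcoord" where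
  "in_block_swap h i i' Z = (\<chi> q. Z $ swp (h, i) (h, i') q)"

text \<open>G_{n,k}: generated by the generators under composition (the inverse of each
  generator is again a generator, so this is the generated group).\<close>
inductive_set Gnk :: "(('k::finite,'n::finite) hcoord \<Rightarrow> ('k,'n) hcoord) set" where
  id: "id \<in> Gnk"
| bswap: "block_swap h h' \<in> Gnk"
| phase: "phase p \<theta> \<in> Gnk"
| ibswap: "in_block_swap h i i' \<in> Gnk"
| comp: "\<sigma> \<in> Gnk \<Longrightarrow> \<tau> \<in> Gnk \<Longrightarrow> \<sigma> \<circ> \<tau> \<in> Gnk"

definition G_invariant :: "(('k::finite,'n::finite) hcoord \<Rightarrow> real) \<Rightarrow> bool" where
  "G_invariant phi \<longleftrightarrow> (\<forall>\<sigma>\<in>Gnk. \<forall>Z. Z \<noteq> 0 \<longrightarrow> phi (\<sigma> Z) = phi Z)"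

definition detS :: "'i set \<Rightarrow> ('i \<Rightarrow> 'i \<Rightarrow> complex) \<Rightarrow> complex" where
  "detS S A = (\<Sum>p | p permutes S. of_int (sign p) * (\<Prod>i\<in>S. A i (p i)))"

definition chart_pt :: "'i::finite \<Rightarrow> complex ^ 'i \<Rightarrow> complex ^ 'i" where
  "chart_pt p0 Z = (\<chi> q. if q = p0 then 1 else Z $ q)"

text \<open>Integral over P_m(C) w.r.t. the volume element dv of g = a * (Fubini-Study),
  computed in the affine chart {z_{p0} = 1} (complement of measure zero):
  dv = det(g_{l m}) dLebesgue(chart coordinates).  The chart coordinates are the
  coordinates Z $ q, q \<noteq> p0, of a vector Z; the redundant coordinate Z $ p0 is
  integrated against the indicator of the unit square (Lebesgue measure 1),
  so by Fubini this is exactly the Lebesgue integral over C^m.\<close>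
definition vol_integral :: "real \<Rightarrow> 'i::finite \<Rightarrow> (complex ^ 'i \<Rightarrow> real) \<Rightarrow> ennreal" where
  "vol_integral a p0 f =
     (\<integral>\<^sup>+ Z. ennreal (indicator {z. 0 \<le> Re z \<and> Re z \<le> 1 \<and> 0 \<le> Im z \<and> Im z \<le> 1} (Z $ p0)
        * Re (detS (- {p0}) (wirt2 (fs_pot a) (chart_pt p0 Z)))
        * f (chart_pt p0 Z)) \<partial>lborel)"

end

theory Submission
  imports Defs
begin

text \<open>
  By torus invariance, \<open>u x = N ln (\<Sum>\<^sub>q exp x\<^sub>q) + \<phi> (exp (x / 2))\<close> with \<open>N = kn\<close> is a function on
  \<open>\<real>\<^sup>N\<close>; admissibility makes it convex, and \<open>u (x + s \<one>) = u x + N s\<close>.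
  The normalisation \<open>sup \<phi> = 0\<close> forces \<open>u 0 \<ge> 0\<close>: if \<open>\<phi>\<close> almost vanishes at \<open>x\<close> and \<open>M\<close> is the
  largest entry of \<open>x\<close>, then \<open>x\<close> is the midpoint of \<open>M \<one>\<close> and a point below \<open>x\<close>.
  As \<open>G\<^sub>n\<^sub>,\<^sub>k\<close> permutes the coordinates transitively, Jensen's inequality compares \<open>u x\<close> with its
  value at the mean of \<open>x\<close>, so \<open>u x \<ge> \<Sum>\<^sub>q x\<^sub>q\<close>. In homogeneous coordinates this is the pointwise bound
  \<open>exp (- \<phi>) \<le> |Z|^(2N) / \<Prod>\<^sub>q |z\<^sub>q|\<^sup>2\<close>, whose powers of exponent \<open>\<alpha> < 1\<close> are integrable against
  the volume density, a constant multiple of \<open>|Z|^(-2N)\<close>.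
\<close>

subsection \<open>The volume density of the Fubini--Study metric\<close>

text \<open>Composing with the transposition of \<open>a\<close> and \<open>b\<close> rearranges the
  permutations of \<open>T\<close> and flips every sign, so the sum equals its own negative.\<close>

lemma sum_sign_permutes_eq_0:
  assumes "finite T" "a \<in> T" "b \<in> T" "a \<noteq> b"
  shows "(\<Sum>p | p permutes T. of_int (sign p) :: complex) = 0"
proof -
  let ?S = "\<Sum>p | p permutes T. of_int (sign p) :: complex"
  have t: "Transposition.transpose a b permutes T"
    using assms by (simp add: permutes_swap_id)
  have "?S = (\<Sum>p | p permutes T. of_int (sign (p \<circ> Transposition.transpose a b)))"
    by (rule sum_permutations_compose_right[OF t])
  also have "\<dots> = (\<Sum>p | p permutes T. - of_int (sign p))"
    using assms t
    by (intro sum.cong refl)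
       (auto simp: sign_compose permutes_imp_permutation[of T] sign_swap_id)
  also have "\<dots> = - ?S" by (simp add: sum_negf)
  finally show ?thesis by simp
qed

text \<open>Expanding the product over subsets \<open>T\<close> of rows taken from the rank-one part leaves a sum
  of signs over the permutations of \<open>T\<close>, which vanishes once \<open>T\<close> has two elements.\<close>

lemma detS_scalar_plus_rank_one:
  fixes u v :: "'i \<Rightarrow> complex"
  assumes fin: "finite S"
  shows "detS S (\<lambda>l m. (if l = m then c else 0) + u l * v m)
         = c ^ card S + c ^ (card S - 1) * (\<Sum>l\<in>S. u l * v l)"
proof -
  define h where "h T p = of_int (sign p) * ((\<Prod>i\<in>T. u i * v (p i)) *
      (\<Prod>i\<in>S - T. if i = p i then c else 0))" for T p
  define K where "K T = (\<Prod>i\<in>T. u i) * (\<Prod>i\<in>T. v i) * c ^ card (S - T)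
      * (\<Sum>p | p permutes T. of_int (sign p))" for T
  have "detS S (\<lambda>l m. (if l = m then c else 0) + u l * v m)
      = (\<Sum>p | p permutes S. of_int (sign p) * (\<Prod>i\<in>S. u i * v (p i) + (if i = p i then c else 0)))"
    by (simp add: detS_def add.commute)
  also have "\<dots> = (\<Sum>p | p permutes S. \<Sum>T\<in>Pow S. h T p)"
    using fin by (simp add: prod_add h_def sum_distrib_left)
  also have "\<dots> = (\<Sum>T\<in>Pow S. \<Sum>p | p permutes S. h T p)"
    by (rule sum.swap)
  also have "\<dots> = (\<Sum>T\<in>Pow S. K T)"
  proof (rule sum.cong[OF refl])
    fix T assume "T \<in> Pow S"
    then have T: "T \<subseteq> S" "finite T" using fin finite_subset by auto
    \<comment> \<open>The scalar part is diagonal: a permutation that moves a point of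
      \<open>S - T\<close> meets a zero factor there, so only permutations of \<open>T\<close>
      contribute.\<close>
    have "(\<Sum>p | p permutes S. h T p) = (\<Sum>p | p permutes T. h T p)"
    proof (rule sum.mono_neutral_right)
      show "finite {p. p permutes S}" using fin by (rule finite_permutations)
      show "{p. p permutes T} \<subseteq> {p. p permutes S}" using T permutes_subset by blast
      show "\<forall>p\<in>{p. p permutes S} - {p. p permutes T}. h T p = 0"
      proof
        fix p assume "p \<in> {p. p permutes S} - {p. p permutes T}"
        then obtain x where "x \<in> S - T" "p x \<noteq> x"
          using permutes_superset[of p S T] by auto
        then have "(\<Prod>i\<in>S - T. if i = p i then c else 0) = 0"
          using fin by (intro prod_zero bexI[of _ x]) auto
        then show "h T p = 0" by (simp add: h_def)
      qed
    qed
    also have "\<dots> = (\<Sum>p | p permutes T. (\<Prod>i\<in>T. u i) * (\<Prod>i\<in>T. v i) * c ^ card (S - T) * of_int (sign p))"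
    proof (rule sum.cong[OF refl])
      fix p assume "p \<in> {p. p permutes T}"
      then have p: "p permutes T" by simp
      have "(\<Prod>i\<in>T. v (p i)) = (\<Prod>i\<in>T. v i)"
        using prod.permute[OF p, of v] by (simp add: o_def)
      moreover have "(\<Prod>i\<in>S - T. if i = p i then c else 0) = (\<Prod>i\<in>S - T. c)"
        using p by (intro prod.cong) (auto simp: permutes_not_in)
      ultimately show "h T p = (\<Prod>i\<in>T. u i) * (\<Prod>i\<in>T. v i) * c ^ card (S - T) * of_int (sign p)"
        by (simp add: h_def prod.distrib)
    qed
    also have "\<dots> = K T" by (simp add: K_def sum_distrib_left)
    finally show "(\<Sum>p | p permutes S. h T p) = K T" .
  qed
  also have "\<dots> = (\<Sum>T\<in>insert {} ((\<lambda>l. {l}) ` S). K T)"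
  proof (rule sum.mono_neutral_right)
    show "\<forall>T\<in>Pow S - insert {} ((\<lambda>l. {l}) ` S). K T = 0"
    proof
      fix T assume T: "T \<in> Pow S - insert {} ((\<lambda>l. {l}) ` S)"
      then obtain a where a: "a \<in> T" by auto
      with T obtain b where b: "b \<in> T" "a \<noteq> b" by blast
      have "finite T" using T fin finite_subset by auto
      from sum_sign_permutes_eq_0[OF this a b] show "K T = 0" by (simp add: K_def)
    qed
  qed (use fin in auto)
  also have "\<dots> = K {} + (\<Sum>l\<in>S. K {l})"
    using fin by (subst sum.insert) (auto simp: sum.reindex inj_on_def)
  also have "\<dots> = c ^ card S + c ^ (card S - 1) * (\<Sum>l\<in>S. u l * v l)"
  proof -
    have "K {} = c ^ card S" by (simp add: K_def)
    moreover have "K {l} = c ^ (card S - 1) * (u l * v l)" if "l \<in> S" for l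
      using that fin by (simp add: K_def card_Diff_singleton)
    ultimately show ?thesis by (simp add: sum_distrib_left)
  qed
  finally show ?thesis .
qed

section \<open>First and second derivatives of the Fubini-Study potential\<close>

lemma fs_pot_has_derivative:
  fixes Z :: "complex ^ 'i"
  assumes "Z \<noteq> 0"
  shows "(fs_pot a has_derivative (\<lambda>v. 2 * a * (Z \<bullet> v) / (Z \<bullet> Z))) (at Z)"
proof -
  have eq: "fs_pot a = (\<lambda>Y :: complex ^ 'i. a * ln (Y \<bullet> Y))"
    by (simp add: fs_pot_def fun_eq_iff power2_norm_eq_inner)
  have "Z \<bullet> Z > 0" using assms by simp
  have "((\<lambda>Y. Y \<bullet> Y) has_derivative (\<lambda>v. Z \<bullet> v + v \<bullet> Z)) (at Z)"
    by (rule has_derivative_inner[OF has_derivative_ident has_derivative_ident])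
  from DERIV_compose_FDERIV[OF DERIV_ln[OF \<open>Z \<bullet> Z > 0\<close>] this]
  have "((\<lambda>Y. a * ln (Y \<bullet> Y)) has_derivative (\<lambda>v. a * ((Z \<bullet> v + v \<bullet> Z) * inverse (Z \<bullet> Z)))) (at Z)"
    by (rule has_derivative_mult_right)
  then show ?thesis unfolding eq
  proof (rule has_derivative_eq_rhs)
    show "(\<lambda>v. a * ((Z \<bullet> v + v \<bullet> Z) * inverse (Z \<bullet> Z))) = (\<lambda>v. 2 * a * (Z \<bullet> v) / (Z \<bullet> Z))"
    proof
      fix v
      show "a * ((Z \<bullet> v + v \<bullet> Z) * inverse (Z \<bullet> Z)) = 2 * a * (Z \<bullet> v) / (Z \<bullet> Z)"
        unfolding inner_commute[of v Z] by (simp add: divide_inverse)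
    qed
  qed
qed

lemma frechet_fs_pot:
  fixes Z :: "complex ^ 'i"
  assumes "Z \<noteq> 0"
  shows "frechet_derivative (fs_pot a) (at Z) = (\<lambda>v. 2 * a * (Z \<bullet> v) / (Z \<bullet> Z))"
  by (rule frechet_derivative_at[OF fs_pot_has_derivative[OF assms], symmetric])

lemma frechet_fs_pot_has_derivative:
  fixes Z :: "complex ^ 'i"
  assumes "Z \<noteq> 0"
  shows "((\<lambda>Y. frechet_derivative (fs_pot a) (at Y) v) has_derivative
     (\<lambda>w. 2 * a * ((v \<bullet> w) / (Z \<bullet> Z) - 2 * (Z \<bullet> v) * (Z \<bullet> w) / (Z \<bullet> Z)\<^sup>2))) (at Z)"
proof (rule has_derivative_transform_within_open[where s = "- {0}"])
  have Z: "Z \<bullet> Z \<noteq> 0" using assms by simp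
  have "((\<lambda>Y. 2 * a * (Y \<bullet> v)) has_derivative (\<lambda>w. 2 * a * (w \<bullet> v))) (at Z)"
    by (intro has_derivative_mult_right has_derivative_inner_left has_derivative_ident)
  moreover have "((\<lambda>Y. Y \<bullet> Y) has_derivative (\<lambda>v. Z \<bullet> v + v \<bullet> Z)) (at Z)"
    by (rule has_derivative_inner[OF has_derivative_ident has_derivative_ident])
  ultimately have "((\<lambda>Y. 2 * a * (Y \<bullet> v) / (Y \<bullet> Y)) has_derivative
     (\<lambda>w. (2 * a * (w \<bullet> v) * (Z \<bullet> Z) - 2 * a * (Z \<bullet> v) * (Z \<bullet> w + w \<bullet> Z)) / ((Z \<bullet> Z) * (Z \<bullet> Z)))) (at Z)"
    using Z by (rule has_derivative_divide')
  then show "((\<lambda>Y. 2 * a * (Y \<bullet> v) / (Y \<bullet> Y)) has_derivative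
     (\<lambda>w. 2 * a * ((v \<bullet> w) / (Z \<bullet> Z) - 2 * (Z \<bullet> v) * (Z \<bullet> w) / (Z \<bullet> Z)\<^sup>2))) (at Z)"
  proof (rule has_derivative_eq_rhs)
    show "(\<lambda>w. (2 * a * (w \<bullet> v) * (Z \<bullet> Z) - 2 * a * (Z \<bullet> v) * (Z \<bullet> w + w \<bullet> Z)) / ((Z \<bullet> Z) * (Z \<bullet> Z)))
      = (\<lambda>w. 2 * a * ((v \<bullet> w) / (Z \<bullet> Z) - 2 * (Z \<bullet> v) * (Z \<bullet> w) / (Z \<bullet> Z)\<^sup>2))"
    proof
      fix w
      show "(2 * a * (w \<bullet> v) * (Z \<bullet> Z) - 2 * a * (Z \<bullet> v) * (Z \<bullet> w + w \<bullet> Z)) / ((Z \<bullet> Z) * (Z \<bullet> Z))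
        = 2 * a * ((v \<bullet> w) / (Z \<bullet> Z) - 2 * (Z \<bullet> v) * (Z \<bullet> w) / (Z \<bullet> Z)\<^sup>2)"
        unfolding inner_commute[of w v] inner_commute[of w Z]
        using Z by (simp add: field_simps power2_eq_square)
    qed
  qed
qed (use assms in \<open>auto simp: frechet_fs_pot\<close>)

lemma D2_fs_pot:
  fixes Z :: "complex ^ 'i"
  assumes "Z \<noteq> 0"
  shows "D2 (fs_pot a) Z v w =
     2 * a * ((v \<bullet> w) / (Z \<bullet> Z) - 2 * (Z \<bullet> v) * (Z \<bullet> w) / (Z \<bullet> Z)\<^sup>2)"
  unfolding D2_def
  by (rule fun_cong[OF frechet_derivative_at[OF frechet_fs_pot_has_derivative[OF assms], symmetric]])


text \<open>The inner product of two axis directions vanishes unless \<open>l = m\<close>, which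
  leaves a scalar matrix; the remaining term of the Hessian factors into a function of
  \<open>l\<close> times a function of \<open>m\<close>. This is the shape that
  \<open>detS_scalar_plus_rank_one\<close> accepts.\<close>

lemma wirt2_fs_pot:
  fixes Z :: "complex ^ 'i"
  assumes "Z \<noteq> 0"
  shows "wirt2 (fs_pot a) Z l m = (if l = m then complex_of_real (a / (norm Z)\<^sup>2) else 0)
     + (- complex_of_real (a / (norm Z) ^ 4) * cnj (Z $ l)) * Z $ m"
proof -
  have ZZ: "Z \<bullet> Z = (norm Z)\<^sup>2" by (simp add: power2_norm_eq_inner)
  have R4: "((norm Z)\<^sup>2)\<^sup>2 = (norm Z) ^ 4" by simp
  have in1: "axis l x \<bullet> axis m y = (if l = m then x \<bullet> y else 0)" for x y :: complex
    by (simp add: inner_axis) (simp add: axis_def)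
  show ?thesis
    unfolding wirt2_def D2_fs_pot[OF assms] ZZ R4 in1
    by (cases "l = m") (simp_all add: complex_eq_iff inner_axis inner_complex_def algebra_simps add_divide_distrib diff_divide_distrib)
qed

lemma norm_vec_power2:
  fixes Z :: "complex ^ 'i"
  shows "(norm Z)\<^sup>2 = (\<Sum>q\<in>UNIV. (norm (Z $ q))\<^sup>2)"
  by (simp add: norm_vec_def L2_set_def sum_nonneg)

text \<open>Put \<open>R = |Z|^2\<close> and \<open>M = CARD('i) - 1\<close>. As the coordinate
  \<open>p0\<close> is 1, the others have squared moduli summing to \<open>R - 1\<close>, so the
  determinant is \<open>(a/R)^M * (1 - (R-1)/R) = a^M / R^(M+1)\<close>.\<close>

lemma detS_fs_pot_chart:
  fixes Z :: "complex ^ 'i"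
  assumes "Z $ p0 = 1"
  shows "detS (- {p0}) (wirt2 (fs_pot a) Z)
     = complex_of_real (a ^ (CARD('i) - 1) / (norm Z)\<^sup>2 ^ CARD('i))"
proof -
  define R where "R = (norm Z)\<^sup>2"
  have Z0: "Z \<noteq> 0" using assms by auto
  then have R0: "R > 0" by (simp add: R_def)
  define M where "M = CARD('i) - 1"
  have N: "CARD('i) = Suc M" by (simp add: M_def)
  have cM: "card (- {p0}) = M" by (simp add: card_Diff_singleton Compl_eq_Diff_UNIV M_def)
  have R: "R = 1 + (\<Sum>q\<in>-{p0}. (norm (Z $ q))\<^sup>2)"
    using assms unfolding R_def norm_vec_power2
    by (subst sum.remove[of _ p0]) (auto simp: Compl_eq_Diff_UNIV)
  have R4: "norm Z ^ 4 = R\<^sup>2" by (simp add: R_def)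
  have "detS (- {p0}) (wirt2 (fs_pot a) Z) = complex_of_real (a / R) ^ M
     + complex_of_real (a / R) ^ (M - 1) * (\<Sum>l\<in>-{p0}. (- complex_of_real (a / R\<^sup>2) * cnj (Z $ l)) * Z $ l)"
    unfolding wirt2_fs_pot[OF Z0] R4 R_def[symmetric]
    by (subst detS_scalar_plus_rank_one) (simp_all add: cM)
  also have "(\<Sum>l\<in>-{p0}. (- complex_of_real (a / R\<^sup>2) * cnj (Z $ l)) * Z $ l)
     = complex_of_real (- (a / R\<^sup>2) * (R - 1))"
  proof -
    have "(\<Sum>l\<in>-{p0}. (- complex_of_real (a / R\<^sup>2) * cnj (Z $ l)) * Z $ l)
        = - complex_of_real (a / R\<^sup>2) * (\<Sum>l\<in>-{p0}. Z $ l * cnj (Z $ l))"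
      by (simp add: sum_distrib_left mult_ac)
    also have "(\<Sum>l\<in>-{p0}. Z $ l * cnj (Z $ l)) = complex_of_real (R - 1)"
      using R by (simp flip: complex_norm_square)
    finally show ?thesis by simp
  qed
  also have "complex_of_real (a / R) ^ M + complex_of_real (a / R) ^ (M - 1) * complex_of_real (- (a / R\<^sup>2) * (R - 1))
     = complex_of_real ((a / R) ^ M + (a / R) ^ (M - 1) * (- (a / R\<^sup>2) * (R - 1)))"
    by simp
  also have "(a / R) ^ M + (a / R) ^ (M - 1) * (- (a / R\<^sup>2) * (R - 1)) = a ^ M / R ^ Suc M"
  proof (cases M)
    \<comment> \<open>Here the truncated exponent \<open>M - 1\<close> is 0 instead of -1; no harm
      results, since projective space is a point, \<open>R = 1\<close>, and the second summand
      vanishes.\<close>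
    case 0
    then have "- {p0} = {}" using cM by (simp add: card_eq_0_iff)
    then have "R = 1" using R by simp
    with 0 show ?thesis by simp
  next
    case (Suc k)
    then show ?thesis using R0 by (simp add: field_simps power2_eq_square)
  qed
  finally show ?thesis by (simp add: N R_def)
qed

subsection \<open>The complex Hessian in logarithmic coordinates\<close>

lemma has_vector_derivative_vec_lambda:
  fixes f :: "'i::finite \<Rightarrow> real \<Rightarrow> 'b::euclidean_space"
  assumes "\<And>q. (f q has_vector_derivative f' q) (at t)"
  shows "((\<lambda>t. \<chi> q. f q t) has_vector_derivative (\<chi> q. f' q)) (at t)"
proof -
  have bl: "bounded_linear (axis q :: 'b \<Rightarrow> 'b ^ 'i)" for q
    unfolding linear_conv_bounded_linear[symmetric]
    by (rule linearI) (auto simp: axis_def vec_eq_iff)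
  have eq: "(\<chi> q. g q) = (\<Sum>q\<in>UNIV. axis q (g q))" for g :: "'i \<Rightarrow> 'b"
    by (simp add: vec_eq_iff axis_def)
  show ?thesis unfolding eq
    by (intro has_vector_derivative_sum bounded_linear.has_vector_derivative[OF bl] assms)
qed

lemma complex_vec_expansion:
  fixes b :: "complex ^ 'i"
  shows "b = (\<Sum>q\<in>UNIV. Re (b $ q) *\<^sub>R axis q 1 + Im (b $ q) *\<^sub>R axis q \<i>)"
  by (simp add: vec_eq_iff axis_def complex_eq_iff if_distrib[of "\<lambda>x. _ * x"] if_distrib[of Re] if_distrib[of Im] cong: if_cong)

text \<open>\<open>F\<close> is constant on the circle obtained by rotating the coordinate
  \<open>q\<close> of \<open>Y\<close>. The velocity of this circle at angle 0 is
  \<open>\<i> * Y $ q\<close>, with real part \<open>- Im (Y $ q)\<close> and imaginary part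
  \<open>Re (Y $ q)\<close>.\<close>

lemma frechet_derivative_phase_direction:
  fixes F :: "complex ^ 'i \<Rightarrow> real"
  assumes d: "F differentiable (at Y)"
    and inv: "\<And>\<theta>. F (\<chi> r. if r = q then exp (\<i> * complex_of_real \<theta>) * Y $ r else Y $ r) = F Y"
  shows "- Im (Y $ q) * frechet_derivative F (at Y) (axis q 1)
         + Re (Y $ q) * frechet_derivative F (at Y) (axis q \<i>) = 0"
proof -
  define \<gamma> where "\<gamma> \<theta> = (\<chi> r. if r = q then exp (\<i> * complex_of_real \<theta>) * Y $ r else Y $ r)" for \<theta>
  let ?D = "frechet_derivative F (at Y)"
  have "((\<lambda>\<theta>. if r = q then exp (\<i> * complex_of_real \<theta>) * Y $ r else Y $ r)
      has_vector_derivative (if r = q then \<i> * Y $ r else 0)) (at 0)" for r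
  proof (cases "r = q")
    case True
    have "((\<lambda>\<theta>. exp (\<i> * complex_of_real \<theta>) * Y $ q) has_vector_derivative \<i> * Y $ q) (at 0)"
      by (auto intro!: derivative_eq_intros has_vector_derivative_real_field)
    with True show ?thesis by simp
  qed simp
  from has_vector_derivative_vec_lambda[of "\<lambda>r \<theta>. if r = q then exp (\<i> * complex_of_real \<theta>) * Y $ r else Y $ r", OF this]
  have g': "(\<gamma> has_vector_derivative (\<chi> r. if r = q then \<i> * Y $ r else 0)) (at 0)"
    by (simp add: \<gamma>_def[abs_def])
  have "(\<chi> r. if r = q then \<i> * Y $ r else 0) = (- Im (Y $ q)) *\<^sub>R axis q 1 + Re (Y $ q) *\<^sub>R axis q \<i>"
    by (simp add: vec_eq_iff axis_def complex_eq_iff)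
  note g' = g'[unfolded this]
  have g0: "\<gamma> 0 = Y" by (simp add: \<gamma>_def vec_eq_iff)
  have "(F has_derivative ?D) (at (\<gamma> 0))"
    using d frechet_derivative_works g0 by auto
  from diff_chain_at[OF g'[unfolded has_vector_derivative_def] this]
  have "((\<lambda>\<theta>. F (\<gamma> \<theta>)) has_derivative
      (\<lambda>h. ?D (h *\<^sub>R ((- Im (Y $ q)) *\<^sub>R axis q 1 + Re (Y $ q) *\<^sub>R axis q \<i>)))) (at 0)"
    by (simp add: o_def)
  moreover have "((\<lambda>\<theta>. F (\<gamma> \<theta>)) has_derivative (\<lambda>h. 0)) (at 0)"
    using inv by (simp add: \<gamma>_def)
  ultimately have "(\<lambda>h. ?D (h *\<^sub>R ((- Im (Y $ q)) *\<^sub>R axis q 1 + Re (Y $ q) *\<^sub>R axis q \<i>))) = (\<lambda>h. 0)"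
    by (rule has_derivative_unique)
  then have "?D (1 *\<^sub>R ((- Im (Y $ q)) *\<^sub>R axis q 1 + Re (Y $ q) *\<^sub>R axis q \<i>)) = 0"
    by meson
  then have "?D ((- Im (Y $ q)) *\<^sub>R axis q 1 + Re (Y $ q) *\<^sub>R axis q \<i>) = 0"
    by simp
  then show ?thesis
    using linear_frechet_derivative[OF d] by (simp only: linear_add linear_scale real_scaleR_def)
qed

text \<open>The amount of regularity that the argument takes from smoothness, shared by
  \<open>phi\<close> and \<open>fs_pot\<close>. The origin is excluded because the logarithm is
  singular there.\<close>

definition twice_differentiable :: "(complex ^ 'i \<Rightarrow> real) \<Rightarrow> bool" where
  "twice_differentiable F \<longleftrightarrow> (\<forall>Y. Y \<noteq> 0 \<longrightarrow> F differentiable (at Y) \<and>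
      (\<forall>v. (\<lambda>Y. frechet_derivative F (at Y) v) differentiable (at Y)))"

definition torus_invariant :: "(complex ^ 'i \<Rightarrow> real) \<Rightarrow> bool" where
  "torus_invariant F \<longleftrightarrow> (\<forall>Y q \<theta>. Y \<noteq> 0 \<longrightarrow>
      F (\<chi> r. if r = q then exp (\<i> * complex_of_real \<theta>) * Y $ r else Y $ r) = F Y)"

text \<open>Obtained by differentiating the infinitesimal phase invariance
  in an imaginary direction.\<close>

lemma D2_imaginary_directions:
  fixes F :: "complex ^ 'i \<Rightarrow> real"
  assumes F: "twice_differentiable F" "torus_invariant F"
    and Z: "Z \<noteq> 0" "\<And>q. Im (Z $ q) = 0"
  shows "Re (Z $ q) * D2 F Z (axis q \<i>) (axis m \<i>)
    = (if q = m then frechet_derivative F (at Z) (axis q 1) else 0)"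
proof -
  define D where "D v Y = frechet_derivative F (at Y) v" for v Y
  have D: "(D v has_derivative D2 F Z v) (at Z)" for v
    using F Z unfolding twice_differentiable_def D2_def D_def
    by (subst frechet_derivative_works[symmetric]) auto
  define P where "P Y = - Im (Y $ q) * D (axis q 1) Y + Re (Y $ q) * D (axis q \<i>) Y" for Y
  have I: "((\<lambda>Y. - Im (Y $ q)) has_derivative (\<lambda>b. - Im (b $ q))) (at Z)"
    by (intro has_derivative_minus bounded_linear_imp_has_derivative bounded_linear_Im[THEN bounded_linear_compose] bounded_linear_vec_nth)
  have R: "((\<lambda>Y. Re (Y $ q)) has_derivative (\<lambda>b. Re (b $ q))) (at Z)"
    by (intro bounded_linear_imp_has_derivative bounded_linear_Re[THEN bounded_linear_compose] bounded_linear_vec_nth)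
  have "(P has_derivative (\<lambda>b. (- Im (Z $ q) * D2 F Z (axis q 1) b + - Im (b $ q) * D (axis q 1) Z)
      + (Re (Z $ q) * D2 F Z (axis q \<i>) b + Re (b $ q) * D (axis q \<i>) Z))) (at Z)"
    unfolding P_def[abs_def] by (intro has_derivative_add has_derivative_mult I R D)
  moreover have "(P has_derivative (\<lambda>b. 0)) (at Z)"
  proof (rule has_derivative_transform_within_open[where s = "- {0}" and f = "\<lambda>_. 0"])
    show "0 = P Y" if "Y \<in> - {0}" for Y
      unfolding P_def D_def
      by (rule frechet_derivative_phase_direction[symmetric])
         (use F that in \<open>auto simp: twice_differentiable_def torus_invariant_def\<close>)
  qed (use Z in auto)
  ultimately have "(\<lambda>b. (- Im (Z $ q) * D2 F Z (axis q 1) b + - Im (b $ q) * D (axis q 1) Z)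
      + (Re (Z $ q) * D2 F Z (axis q \<i>) b + Re (b $ q) * D (axis q \<i>) Z)) = (\<lambda>b. 0)"
    by (rule has_derivative_unique)
  \<comment> \<open>In the direction \<open>axis m \<i>\<close> at a real point, the first and last
    of the four product-rule terms vanish, and the other two give the claim.\<close>
  then have "(- Im (Z $ q) * D2 F Z (axis q 1) (axis m \<i>) + - Im (axis m \<i> $ q) * D (axis q 1) Z)
      + (Re (Z $ q) * D2 F Z (axis q \<i>) (axis m \<i>) + Re (axis m \<i> $ q) * D (axis q \<i>) Z) = 0"
    by meson
  then show ?thesis
    using Z by (auto simp: axis_def D_def split: if_splits)
qed

text \<open>Logarithmic coordinates: \<open>x $ q\<close> stands for \<open>ln |z_q|^2\<close>,
  whence the factor 1/2.\<close>

definition expv :: "real ^ 'i \<Rightarrow> complex ^ 'i" where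
  "expv x = (\<chi> q. complex_of_real (exp (x $ q / 2)))"

lemma expv_nth [simp]: "expv x $ q = complex_of_real (exp (x $ q / 2))"
  by (simp add: expv_def)

lemma expv_nonzero [simp]: "expv x \<noteq> 0"
  by (metis exp_not_eq_zero expv_nth of_real_eq_0_iff zero_index)

text \<open>The second derivative along the curve \<open>c\<close> is the real Hessian on its
  velocity \<open>w\<close> plus a first-order term from its acceleration. By
  \<open>D2_imaginary_directions\<close> the latter equals the Hessian in the imaginary directions,
  and the two together form four times the complex Hessian of \<open>F\<close> on
  \<open>w\<close>.\<close>

lemma expv_line_derivatives:
  fixes F :: "complex ^ 'i \<Rightarrow> real" and x v :: "real ^ 'i"
  assumes F: "twice_differentiable F" "torus_invariant F"
  defines "c \<equiv> \<lambda>t. expv (x + t *\<^sub>R v)"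
    and "w \<equiv> \<lambda>t. (\<chi> q. complex_of_real (v $ q / 2 * exp ((x + t *\<^sub>R v) $ q / 2)))"
  shows "\<exists>g. \<forall>t. ((\<lambda>t. F (c t)) has_real_derivative g t) (at t) \<and>
     (g has_real_derivative
       4 * Re (\<Sum>l\<in>UNIV. \<Sum>m\<in>UNIV. wirt2 F (c t) l m * w t $ l * cnj (w t $ m))) (at t)"
proof -
  define e where "e t q = exp ((x $ q + t * v $ q) / 2)" for t q
  define D where "D u Y = frechet_derivative F (at Y) u" for u Y
  define g where "g t = (\<Sum>q\<in>UNIV. (v $ q / 2 * e t q) * D (axis q 1) (c t))" for t
  have w_nth: "w t $ q = complex_of_real (v $ q / 2 * e t q)" for t q
    by (simp add: w_def e_def)
  have e': "((\<lambda>t. e t q) has_real_derivative v $ q / 2 * e t q) (at t)" for t q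
    unfolding e_def by (auto intro!: derivative_eq_intros)
  have c': "(c has_vector_derivative w t) (at t)" for t
  proof -
    have "((\<lambda>t. complex_of_real (e t q)) has_vector_derivative complex_of_real (v $ q / 2 * e t q)) (at t)" for q
      by (intro has_vector_derivative_of_real e')
    from has_vector_derivative_vec_lambda[of "\<lambda>q t. complex_of_real (e t q)", OF this]
    show ?thesis by (simp add: c_def w_def expv_def e_def)
  qed
  have wsum: "w t = (\<Sum>q\<in>UNIV. (v $ q / 2 * e t q) *\<^sub>R axis q 1)" for t
    by (subst complex_vec_expansion) (simp add: w_nth)
  have chain: "((\<lambda>t. H (c t)) has_real_derivative H' (w t)) (at t)"
    if "(H has_derivative H') (at (c t))" for H :: "complex ^ 'i \<Rightarrow> real" and H' t
  proof -
    have "((\<lambda>t. H (c t)) has_derivative (\<lambda>h. H' (h *\<^sub>R w t))) (at t)"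
      using diff_chain_at[OF c'[unfolded has_vector_derivative_def] that] by (simp add: o_def)
    moreover have "H' (h *\<^sub>R w t) = H' (w t) * h" for h
      using has_derivative_linear[OF that] by (simp add: linear_scale)
    ultimately show ?thesis by (simp add: has_field_derivative_def)
  qed
  have lin: "H' (w t) = (\<Sum>q\<in>UNIV. (v $ q / 2 * e t q) * H' (axis q 1))"
    if "linear H'" for H' :: "complex ^ 'i \<Rightarrow> real" and t
    unfolding wsum using that by (simp add: linear_sum linear_scale)
  have c0: "c t \<noteq> 0" for t by (simp add: c_def)
  have DF: "(F has_derivative (\<lambda>u. D u (c t))) (at (c t))" for t
    using F c0 unfolding twice_differentiable_def D_def
    by (subst frechet_derivative_works[symmetric]) auto
  have DD: "(D u has_derivative D2 F (c t) u) (at (c t))" for u t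
    using F c0 unfolding twice_differentiable_def D2_def D_def
    by (subst frechet_derivative_works[symmetric]) auto
  have g1: "((\<lambda>t. F (c t)) has_real_derivative g t) (at t)" for t
    using chain[OF DF] lin[OF has_derivative_linear[OF DF]] by (simp add: g_def)
  have g2: "(g has_real_derivative
       4 * Re (\<Sum>l\<in>UNIV. \<Sum>m\<in>UNIV. wirt2 F (c t) l m * w t $ l * cnj (w t $ m))) (at t)" for t
  proof -
    define r where "r q = v $ q / 2 * e t q" for q
    define A where "A l m = D2 F (c t) (axis l 1) (axis m 1)" for l m
    define B where "B l m = D2 F (c t) (axis l \<i>) (axis m \<i>)" for l m
    have B: "e t l * B l m = (if l = m then D (axis l 1) (c t) else 0)" for l m
      using D2_imaginary_directions[OF F c0[of t], of l m] by (simp add: B_def D_def c_def e_def)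
    have "(g has_real_derivative (\<Sum>q\<in>UNIV. (v $ q / 2 * (v $ q / 2 * e t q)) * D (axis q 1) (c t)
        + D2 F (c t) (axis q 1) (w t) * (v $ q / 2 * e t q))) (at t)"
      unfolding g_def[abs_def]
      by (intro DERIV_sum DERIV_mult DERIV_cmult e' chain[OF DD])
    moreover have "(\<Sum>q\<in>UNIV. (v $ q / 2 * (v $ q / 2 * e t q)) * D (axis q 1) (c t)
        + D2 F (c t) (axis q 1) (w t) * (v $ q / 2 * e t q))
      = 4 * Re (\<Sum>l\<in>UNIV. \<Sum>m\<in>UNIV. wirt2 F (c t) l m * w t $ l * cnj (w t $ m))"
    proof -
      have "D2 F (c t) (axis q 1) (w t) * (v $ q / 2 * e t q) = (\<Sum>m\<in>UNIV. A q m * r q * r m)" for q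
        by (subst lin[OF has_derivative_linear[OF DD]])
           (simp add: A_def r_def sum_distrib_right sum_distrib_left mult_ac)
      moreover have "(v $ q / 2 * (v $ q / 2 * e t q)) * D (axis q 1) (c t) = (\<Sum>m\<in>UNIV. B q m * r q * r m)" for q
      proof -
        have "(\<Sum>m\<in>UNIV. B q m * r q * r m) = (\<Sum>m\<in>UNIV. (v $ q / 2 * r m) * (e t q * B q m))"
          by (simp add: r_def mult_ac)
        also have "\<dots> = (v $ q / 2 * r q) * D (axis q 1) (c t)"
          unfolding B by (simp add: if_distrib[of "\<lambda>x. _ * x"] cong: if_cong)
        finally show ?thesis by (simp add: r_def)
      qed
      \<comment> \<open>The entries of \<open>w t\<close> are real, so taking the real part drops
        the mixed derivatives in \<open>wirt2\<close>.\<close>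
      moreover have "4 * Re (wirt2 F (c t) l m * w t $ l * cnj (w t $ m)) = (B l m + A l m) * r l * r m" for l m
        by (simp add: wirt2_def w_nth A_def B_def r_def algebra_simps)
      ultimately show ?thesis
        by (simp add: sum.distrib sum_distrib_left distrib_right)
    qed
    ultimately show ?thesis by simp
  qed
  show ?thesis using g1 g2 by blast
qed

subsection \<open>Convexity of the potential\<close>

lemma twice_differentiable_fs_pot: "twice_differentiable (fs_pot a :: complex ^ 'i \<Rightarrow> real)"
  unfolding twice_differentiable_def differentiable_def
  using fs_pot_has_derivative frechet_fs_pot_has_derivative by blast

lemma torus_invariant_fs_pot: "torus_invariant (fs_pot a :: complex ^ 'i \<Rightarrow> real)"
proof -
  have "cmod (if r = q then exp (\<i> * complex_of_real \<theta>) * z else z) = cmod z" for r q :: 'i and \<theta> z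
    by (simp add: norm_mult)
  then show ?thesis by (simp add: torus_invariant_def fs_pot_def norm_vec_power2)
qed

lemma fs_pot_expv: "fs_pot a (expv x) = a * ln (\<Sum>q\<in>UNIV. exp (x $ q))"
proof -
  have "exp (x $ q / 2) ^ 2 = exp (x $ q)" for q
    by (simp flip: exp_of_nat_mult)
  then show ?thesis by (simp add: fs_pot_def norm_vec_power2)
qed

lemma fs_pot_expv_shift: "fs_pot a (expv (x + vec s)) = fs_pot a (expv x) + a * s"
proof -
  have "(\<Sum>q\<in>UNIV. exp ((x + vec s) $ q)) = exp s * (\<Sum>q\<in>UNIV. exp (x $ q))"
    by (simp add: exp_add sum_distrib_left mult_ac)
  moreover have "(\<Sum>q\<in>UNIV. exp (x $ q)) > 0" by (intro sum_pos) auto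
  ultimately show ?thesis by (simp add: fs_pot_expv ln_mult distrib_left)
qed

text \<open>The conditions on \<open>x $ j\<close> and \<open>v $ j\<close> keep the curve in the
  chart where coordinate \<open>j\<close> is 1 and make its velocity vanish in that coordinate. Such
  pairs of point and direction are the ones on which \<open>admissible\<close> gives positivity,
  hence a nonnegative second derivative.\<close>

lemma convex_on_expv_line:
  fixes phi :: "complex ^ 'i \<Rightarrow> real" and x v :: "real ^ 'i"
  assumes phi: "twice_differentiable phi" "torus_invariant phi" "admissible a phi"
    and xv: "x $ j = 0" "v $ j = 0"
  shows "convex_on UNIV (\<lambda>t. fs_pot a (expv (x + t *\<^sub>R v)) + phi (expv (x + t *\<^sub>R v)))"
proof -
  define c where "c t = expv (x + t *\<^sub>R v)" for t
  define w where "w t = (\<chi> q. complex_of_real (v $ q / 2 * exp ((x + t *\<^sub>R v) $ q / 2)))" for t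
  define H where "H F t = 4 * Re (\<Sum>l\<in>UNIV. \<Sum>m\<in>UNIV. wirt2 F (c t) l m * w t $ l * cnj (w t $ m))" for F t
  obtain g1 where g1: "\<And>t. ((\<lambda>t. fs_pot a (c t)) has_real_derivative g1 t) (at t)"
     "\<And>t. (g1 has_real_derivative H (fs_pot a) t) (at t)"
    using expv_line_derivatives[OF twice_differentiable_fs_pot torus_invariant_fs_pot, of a x v]
    unfolding c_def[symmetric] w_def[symmetric] H_def[symmetric] by blast
  obtain g2 where g2: "\<And>t. ((\<lambda>t. phi (c t)) has_real_derivative g2 t) (at t)"
     "\<And>t. (g2 has_real_derivative H phi t) (at t)"
    using expv_line_derivatives[OF phi(1,2), of x v]
    unfolding c_def[symmetric] w_def[symmetric] H_def[symmetric] by blast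
  have "convex_on UNIV (\<lambda>t. fs_pot a (c t) + phi (c t))"
  proof (rule f''_ge0_imp_convex)
    show "((\<lambda>t. fs_pot a (c t) + phi (c t)) has_real_derivative g1 t + g2 t) (at t)" for t
      by (intro DERIV_add g1 g2)
    show "((\<lambda>t. g1 t + g2 t) has_real_derivative H (fs_pot a) t + H phi t) (at t)" for t
      by (intro DERIV_add g1 g2)
    show "H (fs_pot a) t + H phi t \<ge> 0" for t
    proof (cases "w t = 0")
      case True
      then show ?thesis by (simp add: H_def)
    next
      case False
      have "c t $ j = 1" "w t $ j = 0" using xv by (simp_all add: c_def w_def)
      with False phi(3) have "Re (\<Sum>l\<in>UNIV. \<Sum>m\<in>UNIV.
          (wirt2 (fs_pot a) (c t) l m + wirt2 phi (c t) l m) * w t $ l * cnj (w t $ m)) > 0"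
        unfolding admissible_def by blast
      then show ?thesis by (simp add: H_def distrib_right sum.distrib)
    qed
  qed auto
  then show ?thesis by (simp add: c_def)
qed

text \<open>Admissibility only speaks about the slice \<open>x\<^sub>j = 0\<close>; the shift
  behaviour along \<open>\<one>\<close> is affine, so convexity extends to all of \<open>\<real>\<^sup>N\<close>.\<close>

lemma convex_on_expv:
  fixes phi :: "complex ^ 'i \<Rightarrow> real"
  assumes phi: "twice_differentiable phi" "torus_invariant phi" "admissible a phi"
    and shift: "\<And>x s. phi (expv (x + vec s)) = phi (expv x)"
  shows "convex_on UNIV (\<lambda>x. fs_pot a (expv x) + phi (expv x))"
proof (rule convex_onI)
  fix t :: real and x y :: "real ^ 'i"
  assume t: "0 < t" "t < 1"
  define u where "u x = fs_pot a (expv x) + phi (expv x)" for x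
  have us: "u (x + vec s) = u x + a * s" for x s
    by (simp add: u_def shift fs_pot_expv_shift)
  obtain j :: 'i where True by simp
  define x' where "x' = x + vec (- x $ j)"
  define y' where "y' = y + vec (- y $ j)"
  have x: "x = x' + vec (x $ j)" and y: "y = y' + vec (y $ j)"
    by (simp_all add: x'_def y'_def vec_eq_iff)
  have cv: "convex_on UNIV (\<lambda>t. u (x' + t *\<^sub>R (y' - x')))"
    unfolding u_def
    by (rule convex_on_expv_line[OF phi, where j = j]) (simp_all add: x'_def y'_def)
  have "(1 - t) *\<^sub>R x + t *\<^sub>R y = x' + t *\<^sub>R (y' - x') + vec ((1 - t) * x $ j + t * y $ j)"
    by (simp add: x'_def y'_def vec_eq_iff algebra_simps)
  then have "u ((1 - t) *\<^sub>R x + t *\<^sub>R y) = u (x' + t *\<^sub>R (y' - x')) + a * ((1 - t) * x $ j + t * y $ j)"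
    by (simp only: us)
  also have "u (x' + t *\<^sub>R (y' - x')) \<le> (1 - t) * u x' + t * u y'"
    using convex_onD[OF cv, of t 0 1] t by simp
  also have "(1 - t) * u x' + t * u y' + a * ((1 - t) * x $ j + t * y $ j) = (1 - t) * u x + t * u y"
    using us[of x' "x $ j"] us[of y' "y $ j"] x y by (simp add: algebra_simps)
  finally show "fs_pot a (expv ((1 - t) *\<^sub>R x + t *\<^sub>R y)) + phi (expv ((1 - t) *\<^sub>R x + t *\<^sub>R y))
      \<le> (1 - t) * (fs_pot a (expv x) + phi (expv x)) + t * (fs_pot a (expv y) + phi (expv y))"
    by (simp add: u_def)
qed simp

text \<open>Average the rearrangements of \<open>x\<close> over \<open>P\<close>. Jensen's
  inequality bounds \<open>u\<close> at the average by \<open>u x\<close>; transitivity makes all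
  entries of the average equal, and rearranging preserves the sum, so each entry is the
  mean.\<close>

lemma symmetric_convex_ge_at_mean:
  fixes u :: "real ^ 'i \<Rightarrow> real" and P :: "('i \<Rightarrow> 'i) set"
  assumes cv: "convex_on UNIV u"
    and inv: "\<And>\<pi> x. \<pi> \<in> P \<Longrightarrow> u (\<chi> q. x $ \<pi> q) = u x"
    and bij: "\<And>\<pi>. \<pi> \<in> P \<Longrightarrow> bij \<pi>"
    and comp: "\<And>\<pi> \<sigma>. \<pi> \<in> P \<Longrightarrow> \<sigma> \<in> P \<Longrightarrow> \<pi> \<circ> \<sigma> \<in> P"
    and trans: "\<And>q q'. \<exists>\<pi>\<in>P. \<pi> q = q'"
  shows "u (vec ((\<Sum>q\<in>UNIV. x $ q) / real CARD('i))) \<le> u x"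
proof -
  have fin: "finite P" by simp
  have ne: "P \<noteq> {}" using trans by blast
  then have cP: "card P > 0" using fin by (simp add: card_gt_0_iff)
  define y where "y = (\<Sum>\<pi>\<in>P. (1 / real (card P)) *\<^sub>R (\<chi> q. x $ \<pi> q))"
  have y: "y $ q = (\<Sum>\<pi>\<in>P. x $ \<pi> q) / real (card P)" for q
    by (simp add: y_def sum_divide_distrib)
  have const: "y $ q' = y $ q" for q q'
  proof -
    obtain \<sigma> where s: "\<sigma> \<in> P" "\<sigma> q = q'" using trans by blast
    have inj: "inj_on (\<lambda>\<pi>. \<pi> \<circ> \<sigma>) P"
    proof (rule inj_onI)
      fix f g assume "f \<circ> \<sigma> = g \<circ> \<sigma>"
      then show "f = g" using bij[OF s(1)] by (metis bij_is_surj surj_fun_eq)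
    qed
    \<comment> \<open>An injective self-map of a finite set is onto, so closure under composition
      suffices and no inverses have to be supplied.\<close>
    have "(\<lambda>\<pi>. \<pi> \<circ> \<sigma>) ` P = P"
      using inj comp s(1) by (intro endo_inj_surj[OF fin]) auto
    then have "(\<Sum>\<pi>\<in>P. x $ \<pi> q) = (\<Sum>\<pi>\<in>(\<lambda>\<pi>. \<pi> \<circ> \<sigma>) ` P. x $ \<pi> q)" by simp
    also have "\<dots> = (\<Sum>\<pi>\<in>P. x $ \<pi> q')"
      using inj s by (simp add: sum.reindex)
    finally show ?thesis by (simp add: y)
  qed
  have "(\<Sum>q\<in>UNIV. y $ q) = (\<Sum>q\<in>UNIV. x $ q)"
  proof -
    have "(\<Sum>q\<in>UNIV. x $ \<pi> q) = (\<Sum>q\<in>UNIV. x $ q)" if "\<pi> \<in> P" for \<pi>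
      using sum.reindex_bij_betw[OF bij[OF that], of "\<lambda>q. x $ q"] by simp
    then have "(\<Sum>\<pi>\<in>P. \<Sum>q\<in>UNIV. x $ \<pi> q) = card P * (\<Sum>q\<in>UNIV. x $ q)" by simp
    then show ?thesis
      unfolding y sum_divide_distrib[symmetric] using cP ne by (subst sum.swap) simp
  qed
  moreover have "(\<Sum>q\<in>UNIV. y $ q) = real CARD('i) * y $ q0" for q0
    using const by (metis (no_types, lifting) of_nat_mult sum.cong sum_constant)
  ultimately have "y = vec ((\<Sum>q\<in>UNIV. x $ q) / real CARD('i))"
    by (simp add: vec_eq_iff field_simps)
  moreover have "u y \<le> (\<Sum>\<pi>\<in>P. (1 / real (card P)) * u (\<chi> q. x $ \<pi> q))"
    unfolding y_def using cP by (intro convex_on_sum[OF fin ne cv]) auto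
  moreover have "(\<Sum>\<pi>\<in>P. (1 / real (card P)) * u (\<chi> q. x $ \<pi> q)) = u x"
    using ne inv fin by simp
  ultimately show ?thesis by simp
qed

text \<open>Write \<open>N\<close> for the dimension, \<open>M\<close> for the largest entry of
  \<open>x\<close>, and \<open>y = 2 x - M\<close>, entrywise. Then
  \<open>2 u(x) <= u(y) + u(M) <= L(x) + u(0) + N M\<close>, and \<open>N M <= L(x)\<close>. If
  \<open>u(x)\<close> is within \<open>\<epsilon> / 2\<close> of \<open>L(x)\<close>, it follows
  that \<open>u(0) >= - \<epsilon>\<close>.\<close>

lemma convex_ge_0_at_origin:
  fixes u :: "real ^ 'i \<Rightarrow> real"
  defines "L \<equiv> \<lambda>x :: real ^ 'i. real CARD('i) * ln (\<Sum>q\<in>UNIV. exp (x $ q))"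
  assumes cv: "convex_on UNIV u"
    and shift: "\<And>x s. u (x + vec s) = u x + real CARD('i) * s"
    and le: "\<And>x. u x \<le> L x"
    and near: "\<And>\<epsilon>. \<epsilon> > 0 \<Longrightarrow> \<exists>x. u x \<ge> L x - \<epsilon>"
  shows "u 0 \<ge> 0"
proof (rule field_le_epsilon)
  fix \<epsilon> :: real assume "\<epsilon> > 0"
  then obtain x where x: "u x \<ge> L x - \<epsilon> / 2" using near[of "\<epsilon> / 2"] by auto
  define M where "M = Max (range (($) x))"
  have M: "x $ q \<le> M" for q by (simp add: M_def)
  have "M \<in> range (($) x)" unfolding M_def by (intro Max_in) auto
  then obtain q0 where q0: "x $ q0 = M" by auto
  \<comment> \<open>The reflection of \<open>vec M\<close> in \<open>x\<close>. Its entries are at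
    most those of \<open>x\<close>, since no entry of \<open>x\<close> exceeds \<open>M\<close>;
    hence \<open>L y\<close> is at most \<open>L x\<close>.\<close>
  define y where "y = 2 *\<^sub>R x - vec M"
  have pos: "(\<Sum>q\<in>UNIV. exp (z $ q)) > 0" for z :: "real ^ 'i" by (intro sum_pos) auto
  have "(\<Sum>q\<in>UNIV. exp (y $ q)) \<le> (\<Sum>q\<in>UNIV. exp (x $ q))"
    using M by (intro sum_mono) (simp add: y_def)
  then have Ly: "L y \<le> L x" using pos[of y] by (simp add: L_def)
  have "exp M \<le> (\<Sum>q\<in>UNIV. exp (x $ q))"
    using member_le_sum[of q0 UNIV "\<lambda>q. exp (x $ q)"] q0 by simp
  then have LM: "L x \<ge> real CARD('i) * M"
    using pos[of x] by (simp add: L_def ln_ge_iff)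
  have "x = (1 - 1/2) *\<^sub>R y + (1/2) *\<^sub>R vec M"
    by (simp add: y_def vec_eq_iff diff_divide_distrib)
  then have "u x \<le> (1 - 1/2) * u y + (1/2) * u (vec M)"
    using convex_onD[OF cv, of "1/2" y "vec M"] by simp
  then have "2 * u x \<le> u y + u (vec M)" by simp
  moreover have "u (vec M) = u 0 + real CARD('i) * M" using shift[of 0 M] by simp
  moreover have "u y \<le> L x" using le[of y] Ly by simp
  ultimately show "0 \<le> u 0 + \<epsilon>" using x LM by linarith
qed

subsection \<open>The pointwise lower bound\<close>

lemma smooth_proj_imp_twice_differentiable:
  assumes "smooth_proj phi"
  shows "twice_differentiable phi"
proof -
  have "Ck (Suc (Suc 0)) (- {0}) phi"
    using assms by (simp add: smooth_proj_def smooth_on_def del: Ck.simps)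
  then show ?thesis by (auto simp: twice_differentiable_def)
qed

lemma G_invariant_imp_torus_invariant:
  fixes phi :: "('k::finite,'n::finite) hcoord \<Rightarrow> real"
  assumes "G_invariant phi"
  shows "torus_invariant phi"
  unfolding torus_invariant_def
proof (intro allI impI)
  fix Y :: "('k,'n) hcoord" and q \<theta>
  assume "Y \<noteq> 0"
  then have "phi (phase q \<theta> Y) = phi Y"
    using assms Gnk.phase[of q \<theta>] unfolding G_invariant_def by blast
  then show "phi (\<chi> r. if r = q then exp (\<i> * complex_of_real \<theta>) * Y $ r else Y $ r) = phi Y"
    by (simp only: phase_def)
qed

text \<open>A real supremum bounds its set only when the set is bounded above. Homogeneity reduces
  this to the unit sphere, which is compact.\<close>

lemma smooth_proj_le_SUP:
  fixes phi :: "('k::finite,'n::finite) hcoord \<Rightarrow> real"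
  assumes phi: "smooth_proj phi" and "Z \<noteq> 0"
  shows "phi Z \<le> (SUP Z\<in>- {0}. phi Z)"
proof -
  have td: "twice_differentiable phi" using phi by (rule smooth_proj_imp_twice_differentiable)
  have "continuous_on (sphere 0 1) phi"
  proof (intro continuous_at_imp_continuous_on ballI differentiable_imp_continuous_within)
    fix Y :: "('k,'n) hcoord" assume "Y \<in> sphere 0 1"
    then have "Y \<noteq> 0" by auto
    then show "phi differentiable (at Y)" using td unfolding twice_differentiable_def by blast
  qed
  then have "bounded (phi ` sphere 0 1)"
    by (intro compact_imp_bounded compact_continuous_image) auto
  then obtain B where B: "\<And>Y. Y \<in> sphere 0 1 \<Longrightarrow> phi Y \<le> B"
    unfolding bounded_iff by (metis abs_le_D1 image_eqI real_norm_def)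
  have "phi Y \<le> B" if "Y \<noteq> 0" for Y
  proof -
    have "phi Y = phi (\<chi> q. complex_of_real (1 / norm Y) * Y $ q)"
    proof -
      have "complex_of_real (1 / norm Y) \<noteq> 0" using that by simp
      then show ?thesis using phi that unfolding smooth_proj_def proj_fun_def by metis
    qed
    also have "(\<chi> q. complex_of_real (1 / norm Y) * Y $ q) = (1 / norm Y) *\<^sub>R Y"
      by (simp add: vec_eq_iff complex_eq_iff)
    also have "phi \<dots> \<le> B" using that by (intro B) simp
    finally show ?thesis .
  qed
  then have "bdd_above (phi ` (- {0}))" by (intro bdd_aboveI2) auto
  then show ?thesis using assms(2) by (intro cSUP_upper) auto
qed

text \<open>Rotate the coordinates one at a time by minus their argument; the induction runs over
  the set of coordinates already made nonnegative.\<close>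

lemma torus_invariant_abs:
  fixes phi :: "complex ^ 'i \<Rightarrow> real"
  assumes inv: "torus_invariant phi" and nz: "Z \<noteq> 0"
  shows "phi (\<chi> q. complex_of_real (cmod (Z $ q))) = phi Z"
proof -
  have "phi (\<chi> q. if q \<in> S then complex_of_real (cmod (Z $ q)) else Z $ q) = phi Z" if "finite S" for S
    using that
  proof induction
    case (insert p S)
    define W where "W = (\<chi> q. if q \<in> S then complex_of_real (cmod (Z $ q)) else Z $ q)"
    have "W \<noteq> 0" using nz by (auto simp: W_def vec_eq_iff)
    then have "phi (\<chi> r. if r = p then exp (\<i> * complex_of_real (- Arg (Z $ p))) * W $ r else W $ r) = phi W"
      using inv unfolding torus_invariant_def by blast
    moreover have "exp (\<i> * complex_of_real (- Arg (Z $ p))) * Z $ p = complex_of_real (cmod (Z $ p))"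
    proof (cases "Z $ p = 0")
      case False
      have "exp (\<i> * complex_of_real (- Arg (Z $ p))) * Z $ p
          = exp (\<i> * complex_of_real (- Arg (Z $ p))) * (complex_of_real (cmod (Z $ p)) * exp (\<i> * complex_of_real (Arg (Z $ p))))"
        using Arg_eq[OF False] by (rule arg_cong)
      also have "\<dots> = complex_of_real (cmod (Z $ p))"
        by (simp add: exp_minus)
      finally show ?thesis .
    qed simp
    then have "(\<chi> r. if r = p then exp (\<i> * complex_of_real (- Arg (Z $ p))) * W $ r else W $ r)
       = (\<chi> q. if q \<in> insert p S then complex_of_real (cmod (Z $ q)) else Z $ q)"
      using insert.hyps by (auto simp: vec_eq_iff W_def)
    ultimately show ?case using insert.IH by (simp add: W_def)
  qed simp
  from this[of UNIV] show ?thesis by simp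
qed

lemma abs_eq_expv:
  fixes Z :: "complex ^ 'i"
  assumes "\<And>q. Z $ q \<noteq> 0"
  shows "(\<chi> q. complex_of_real (cmod (Z $ q))) = expv (\<chi> q. ln ((cmod (Z $ q))\<^sup>2))"
  using assms by (simp add: vec_eq_iff ln_realpow)

text \<open>Logarithmic coordinates exist only off the coordinate hyperplanes, while a near-maximum
  of \<open>phi\<close> may lie on one. Replacing zero coordinates by a small positive number
  changes \<open>phi\<close> little.\<close>

lemma nonzero_coordinates_approx:
  fixes phi :: "complex ^ 'i \<Rightarrow> real"
  assumes "isCont phi Z" "phi Z > b"
  shows "\<exists>W. phi W > b \<and> (\<forall>q. W $ q \<noteq> 0)"
proof -
  define W where "W \<delta> = (\<chi> q. if Z $ q = 0 then complex_of_real \<delta> else Z $ q)" for \<delta>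
  have "((\<lambda>\<delta>. if Z $ q = 0 then complex_of_real \<delta> else Z $ q) \<longlongrightarrow> Z $ q) (at_right 0)" for q
  proof (cases "Z $ q = 0")
    case True
    have "((\<lambda>\<delta>. complex_of_real \<delta>) \<longlongrightarrow> complex_of_real 0) (at_right 0)"
      by (intro tendsto_intros)
    with True show ?thesis by simp
  qed simp
  then have "(W \<longlongrightarrow> Z) (at_right 0)"
    unfolding W_def by (intro vec_tendstoI) simp
  then have "((\<lambda>\<delta>. phi (W \<delta>)) \<longlongrightarrow> phi Z) (at_right 0)"
    using assms(1) isCont_tendsto_compose by blast
  then have "eventually (\<lambda>\<delta>. phi (W \<delta>) > b) (at_right 0)"
    using assms(2) by (rule order_tendstoD)
  moreover have "eventually (\<lambda>\<delta>::real. \<delta> > 0) (at_right 0)"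
    by (simp add: eventually_at_right_less)
  ultimately have "eventually (\<lambda>\<delta>. phi (W \<delta>) > b \<and> \<delta> > 0) (at_right 0)"
    by eventually_elim simp
  then obtain \<delta> where "phi (W \<delta>) > b" "\<delta> > 0"
    using eventually_happens'[OF trivial_limit_at_right_real] by blast
  then show ?thesis by (intro exI[of _ "W \<delta>"]) (auto simp: W_def)
qed

text \<open>Stands in for the permutation part of \<open>Gnk\<close>: it is closed under composition
  and can be fed directly to \<open>symmetric_convex_ge_at_mean\<close>.\<close>

definition invariant_perms :: "(complex ^ 'i \<Rightarrow> real) \<Rightarrow> ('i \<Rightarrow> 'i) set" where
  "invariant_perms phi = {\<pi>. bij \<pi> \<and> (\<forall>Z. Z \<noteq> 0 \<longrightarrow> phi (\<chi> q. Z $ \<pi> q) = phi Z)}"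

lemma invariant_perms_comp:
  assumes "\<pi> \<in> invariant_perms phi" "\<sigma> \<in> invariant_perms phi"
  shows "\<pi> \<circ> \<sigma> \<in> invariant_perms phi"
proof -
  have "phi (\<chi> q. Z $ \<pi> (\<sigma> q)) = phi Z" if "Z \<noteq> 0" for Z
  proof -
    define W where "W = (\<chi> q. Z $ \<pi> q)"
    have "W \<noteq> 0"
      using that assms(1) unfolding W_def invariant_perms_def
      by (auto simp: vec_eq_iff) (metis bij_pointE)
    then have "phi (\<chi> q. W $ \<sigma> q) = phi W" using assms(2) by (simp add: invariant_perms_def)
    also have "phi W = phi Z" using assms(1) that by (simp add: invariant_perms_def W_def)
    finally show ?thesis by (simp add: W_def)
  qed
  then show ?thesis using assms by (simp add: invariant_perms_def bij_comp)
qed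

lemma swp_swp [simp]: "swp p q (swp p q r) = r"
  by (simp add: swp_def)

text \<open>A block swap carries \<open>(h, i)\<close> to \<open>(h', i)\<close>, and a
  transposition inside block \<open>h'\<close> then carries it to \<open>(h', i')\<close>.\<close>

lemma G_invariant_transitive:
  fixes phi :: "('k::finite,'n::finite) hcoord \<Rightarrow> real"
  assumes "G_invariant phi"
  shows "\<exists>\<pi>\<in>invariant_perms phi. \<pi> q = q'"
proof -
  obtain h i h' i' where q: "q = (h, i)" "q' = (h', i')" by fastforce
  define \<beta> where "\<beta> = (\<lambda>q :: 'k \<times> 'n. (swp h h' (fst q), snd q))"
  define \<iota> where "\<iota> = swp (h', i) (h', i')"
  have "bij \<beta>" by (rule o_bij[of \<beta>]) (auto simp: \<beta>_def)
  moreover have "phi (\<chi> q. Z $ \<beta> q) = phi Z" if "Z \<noteq> 0" for Z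
  proof -
    have "phi (block_swap h h' Z) = phi Z"
      using assms Gnk.bswap[of h h'] that unfolding G_invariant_def by blast
    then show ?thesis by (simp only: block_swap_def \<beta>_def)
  qed
  ultimately have b: "\<beta> \<in> invariant_perms phi" by (simp add: invariant_perms_def)
  have "bij \<iota>" by (rule o_bij[of \<iota>]) (auto simp: \<iota>_def)
  moreover have "phi (\<chi> q. Z $ \<iota> q) = phi Z" if "Z \<noteq> 0" for Z
  proof -
    have "phi (in_block_swap h' i i' Z) = phi Z"
      using assms Gnk.ibswap[of h' i i'] that unfolding G_invariant_def by blast
    then show ?thesis by (simp only: in_block_swap_def \<iota>_def)
  qed
  ultimately have i: "\<iota> \<in> invariant_perms phi" by (simp add: invariant_perms_def)
  have "(\<iota> \<circ> \<beta>) q = q'" by (simp add: q \<iota>_def \<beta>_def swp_def)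
  then show ?thesis using invariant_perms_comp[OF i b] by blast
qed

lemma admissible_lower_bound:
  fixes phi :: "('k::finite,'n::finite) hcoord \<Rightarrow> real"
  assumes phi: "smooth_proj phi" "admissible (real CARD('k \<times> 'n)) phi" "G_invariant phi"
    and sup: "(SUP Z\<in>- {0}. phi Z) = 0"
    and nz: "\<And>q. Z $ q \<noteq> 0"
  shows "phi Z \<ge> (\<Sum>q\<in>UNIV. ln ((cmod (Z $ q))\<^sup>2)) - real CARD('k \<times> 'n) * ln ((norm Z)\<^sup>2)"
proof -
  define N where "N = real CARD('k \<times> 'n)"
  define u where "u x = fs_pot N (expv x) + phi (expv x)" for x :: "real ^ ('k \<times> 'n)"
  have td: "twice_differentiable phi" using phi(1) by (rule smooth_proj_imp_twice_differentiable)
  have ti: "torus_invariant phi" using phi(3) by (rule G_invariant_imp_torus_invariant)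
  have phi_shift: "phi (expv (x + vec s)) = phi (expv x)" for x s
  proof -
    have "expv (x + vec s) = (\<chi> q. complex_of_real (exp (s / 2)) * expv x $ q)"
      by (simp add: vec_eq_iff add_divide_distrib exp_add mult.commute)
    then show ?thesis
      using phi(1) expv_nonzero[of x] unfolding smooth_proj_def proj_fun_def
      by (metis exp_not_eq_zero of_real_eq_0_iff)
  qed
  have cv: "convex_on UNIV u"
    unfolding u_def by (rule convex_on_expv[OF td ti _ phi_shift]) (use phi(2) in \<open>simp add: N_def\<close>)
  have shift: "u (x + vec s) = u x + N * s" for x s
    by (simp add: u_def phi_shift fs_pot_expv_shift)
  have "u 0 \<ge> 0"
  proof (rule convex_ge_0_at_origin[OF cv])
    show "u (x + vec s) = u x + real CARD('k \<times> 'n) * s" for x s using shift by (simp add: N_def)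
    show "u x \<le> real CARD('k \<times> 'n) * ln (\<Sum>q\<in>UNIV. exp (x $ q))" for x
      using smooth_proj_le_SUP[OF phi(1) expv_nonzero[of x]] sup
      by (simp add: u_def fs_pot_expv N_def)
    fix \<epsilon> :: real assume "\<epsilon> > 0"
    have "\<exists>Z\<in>- {0}. phi Z > - \<epsilon>"
    proof (rule ccontr)
      assume "\<not> ?thesis"
      then have "(SUP Z\<in>- {0}. phi Z) \<le> - \<epsilon>"
        by (intro cSUP_least) (auto simp: not_less intro: expv_nonzero)
      with sup \<open>\<epsilon> > 0\<close> show False by simp
    qed
    then obtain Y where Y: "Y \<noteq> 0" "phi Y > - \<epsilon>" by auto
    \<comment> \<open>The near-maximal point is moved off the coordinate hyperplanes and then
      rotated to positive coordinates, so that it has the form \<open>expv x\<close>.\<close>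
    have "isCont phi Y"
      using td Y(1) by (auto simp: twice_differentiable_def intro: differentiable_imp_continuous_within)
    from nonzero_coordinates_approx[OF this Y(2)] obtain W where
      W: "phi W > - \<epsilon>" "\<And>q. W $ q \<noteq> 0" by blast
    define x where "x = (\<chi> q. ln ((cmod (W $ q))\<^sup>2))"
    have "W \<noteq> 0" using W(2) by auto
    then have "phi (expv x) = phi W"
      unfolding x_def abs_eq_expv[OF W(2), symmetric] by (rule torus_invariant_abs[OF ti])
    then have "u x \<ge> real CARD('k \<times> 'n) * ln (\<Sum>q\<in>UNIV. exp (x $ q)) - \<epsilon>"
      using W(1) by (simp add: u_def fs_pot_expv N_def)
    then show "\<exists>x. u x \<ge> real CARD('k \<times> 'n) * ln (\<Sum>q\<in>UNIV. exp (x $ q)) - \<epsilon>" ..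
  qed
  define x where "x = (\<chi> q. ln ((cmod (Z $ q))\<^sup>2))"
  have Z0: "Z \<noteq> 0" using nz by auto
  have "u (vec ((\<Sum>q\<in>UNIV. x $ q) / real CARD('k \<times> 'n))) \<le> u x"
  proof (rule symmetric_convex_ge_at_mean[OF cv, of "invariant_perms phi"])
    fix \<pi> and x :: "real ^ ('k \<times> 'n)" assume pi: "\<pi> \<in> invariant_perms phi"
    then have "(\<Sum>q\<in>UNIV. exp (x $ \<pi> q)) = (\<Sum>q\<in>UNIV. exp (x $ q))"
      using sum.reindex_bij_betw[of \<pi> UNIV UNIV "\<lambda>q. exp (x $ q)"] by (simp add: invariant_perms_def)
    moreover have "phi (expv (\<chi> q. x $ \<pi> q)) = phi (expv x)"
    proof -
      have "expv (\<chi> q. x $ \<pi> q) = (\<chi> q. expv x $ \<pi> q)" by (simp add: vec_eq_iff)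
      also have "phi \<dots> = phi (expv x)"
        using pi expv_nonzero[of x] unfolding invariant_perms_def by blast
      finally show ?thesis .
    qed
    ultimately show "u (\<chi> q. x $ \<pi> q) = u x" by (simp add: u_def fs_pot_expv)
  qed (use invariant_perms_comp G_invariant_transitive[OF phi(3)] in \<open>auto simp: invariant_perms_def\<close>)
  \<comment> \<open>Shifting by the mean adds \<open>N\<close> times the mean, which is the sum of
    the entries.\<close>
  moreover have "u (vec ((\<Sum>q\<in>UNIV. x $ q) / real CARD('k \<times> 'n))) = u 0 + (\<Sum>q\<in>UNIV. x $ q)"
    using shift[of 0 "(\<Sum>q\<in>UNIV. x $ q) / real CARD('k \<times> 'n)"] by (simp add: N_def)
  ultimately have "u x \<ge> (\<Sum>q\<in>UNIV. ln ((cmod (Z $ q))\<^sup>2))"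
    using \<open>u 0 \<ge> 0\<close> by (simp add: x_def)
  moreover have "phi (expv x) = phi Z"
    unfolding x_def abs_eq_expv[OF nz, symmetric] by (rule torus_invariant_abs[OF ti Z0])
  moreover have "fs_pot N (expv x) = N * ln ((norm Z)\<^sup>2)"
    using nz by (simp add: fs_pot_expv x_def norm_vec_power2)
  ultimately show ?thesis by (simp add: u_def N_def)
qed

subsection \<open>The integral\<close>

text \<open>Near 0 the integrand is at most \<open>|r|^(-\<alpha>)\<close> with
  \<open>\<alpha> < 1\<close>; for large \<open>|r|\<close> it is at most
  \<open>|r|^(-(\<alpha>+\<beta>))\<close>, whose exponent exceeds 1 in size.\<close>

lemma nn_integral_powr_finite:
  fixes \<alpha> \<beta> :: real
  assumes "0 \<le> \<alpha>" "\<alpha> < 1" "0 \<le> \<beta>" "\<alpha> + \<beta> > 1"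
  shows "(\<integral>\<^sup>+ r. ennreal (\<bar>r\<bar> powr (- \<alpha>) * (1 + r\<^sup>2) powr (- (\<beta> / 2))) \<partial>lborel) < \<infinity>"
proof -
  \<comment> \<open>A majorant on the nonnegative half-line, zero for negative \<open>r\<close>;
    adding its reflection covers the whole line.\<close>
  define k :: "real \<Rightarrow> ennreal" where "k r = ennreal (r powr (- \<alpha>)) * indicator {0..1} r
    + ennreal (r powr (- (\<alpha> + \<beta>))) * indicator {1..} r" for r
  have k_meas [measurable]: "k \<in> borel_measurable borel" unfolding k_def[abs_def] by measurable
  have "((\<lambda>r. r powr (- \<alpha>)) has_integral (1 powr (- \<alpha> + 1) / (- \<alpha> + 1))) {0..1}"
    using assms by (intro has_integral_powr_from_0) auto
  moreover have "((\<lambda>r. r powr (- (\<alpha> + \<beta>))) has_integral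
      - (1 powr (- (\<alpha> + \<beta>) + 1)) / (- (\<alpha> + \<beta>) + 1)) {1..}"
    using assms by (intro has_integral_powr_to_inf) auto
  ultimately have "integral\<^sup>N lborel k = ennreal (1 powr (- \<alpha> + 1) / (- \<alpha> + 1))
      + ennreal (- (1 powr (- (\<alpha> + \<beta>) + 1)) / (- (\<alpha> + \<beta>) + 1))"
    unfolding k_def by (subst nn_integral_add) (auto simp only: nn_integral_has_integral_lebesgue' powr_ge_zero, measurable)
  then have fin: "integral\<^sup>N lborel k < \<infinity>" by simp
  have refl: "(\<integral>\<^sup>+ r. k (- r) \<partial>lborel) = integral\<^sup>N lborel k"
    using nn_integral_real_affine[OF k_meas, of "-1" 0] by simp
  have pos: "ennreal (\<bar>r\<bar> powr (- \<alpha>) * (1 + r\<^sup>2) powr (- (\<beta> / 2))) \<le> k r" if "r \<ge> 0" for r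
  proof (cases "r \<le> 1")
    case True
    have "(1 + r\<^sup>2) powr (- (\<beta> / 2)) \<le> 1"
      using powr_mono[of "- (\<beta> / 2)" 0 "1 + r\<^sup>2"] assms by (simp add: add_nonneg_eq_0_iff)
    then have "\<bar>r\<bar> powr (- \<alpha>) * (1 + r\<^sup>2) powr (- (\<beta> / 2)) \<le> r powr (- \<alpha>)"
      using that by (simp add: mult_left_le)
    then show ?thesis using True that by (simp add: k_def ennreal_leI add_increasing2)
  next
    case False
    have "(1 + r\<^sup>2) powr (- (\<beta> / 2)) \<le> (r\<^sup>2) powr (- (\<beta> / 2))"
      using assms False by (intro powr_mono2') auto
    also have "(r\<^sup>2) powr (- (\<beta> / 2)) = r powr (- \<beta>)"
      using False by (simp add: powr_powr flip: powr_numeral)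
    finally have "\<bar>r\<bar> powr (- \<alpha>) * (1 + r\<^sup>2) powr (- (\<beta> / 2)) \<le> r powr (- \<alpha>) * r powr (- \<beta>)"
      using that by (simp add: mult_left_mono)
    also have "\<dots> = r powr (- (\<alpha> + \<beta>))" by (simp flip: powr_add)
    finally show ?thesis using False by (simp add: k_def ennreal_leI)
  qed
  have "(\<integral>\<^sup>+ r. ennreal (\<bar>r\<bar> powr (- \<alpha>) * (1 + r\<^sup>2) powr (- (\<beta> / 2))) \<partial>lborel)
      \<le> (\<integral>\<^sup>+ r. k r + k (- r) \<partial>lborel)"
  proof (rule nn_integral_mono)
    fix r :: real
    show "ennreal (\<bar>r\<bar> powr (- \<alpha>) * (1 + r\<^sup>2) powr (- (\<beta> / 2))) \<le> k r + k (- r)"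
    proof (cases "r \<ge> 0")
      case True
      from pos[OF this] show ?thesis by (rule order_trans) simp
    next
      case False
      then have "ennreal (\<bar>r\<bar> powr (- \<alpha>) * (1 + r\<^sup>2) powr (- (\<beta> / 2))) \<le> k (- r)"
        using pos[of "- r"] by simp
      then show ?thesis by (rule order_trans) simp
    qed
  qed
  also have "\<dots> = integral\<^sup>N lborel k + integral\<^sup>N lborel k"
    by (subst nn_integral_add) (simp_all add: refl)
  also have "\<dots> < \<infinity>" using fin by simp
  finally show ?thesis .
qed

section \<open>Product bound in the real and imaginary parts of the coordinates\<close>

lemma prod_Basis_complex_vec:
  fixes g :: "complex ^ 'i \<Rightarrow> 'b::comm_monoid_mult"
  shows "(\<Prod>b\<in>Basis. g b) = (\<Prod>q\<in>UNIV. g (axis q 1) * g (axis q \<i>))"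
proof -
  have B: "(Basis :: (complex ^ 'i) set) = (\<Union>q. {axis q 1, axis q \<i>})"
    by (auto simp: Basis_vec_def Basis_complex_def)
  have ne: "axis q 1 \<noteq> axis q (\<i> :: complex)" for q :: 'i
    by (simp add: axis_eq_axis complex_eq_iff)
  show ?thesis unfolding B
    by (subst prod.UNION_disjoint) (auto simp: axis_eq_axis complex_eq_iff ne)
qed

lemma AE_inner_Basis_nonzero:
  "AE x in (lborel :: 'a::euclidean_space measure). \<forall>b\<in>Basis. x \<bullet> b \<noteq> 0"
proof (rule AE_finite_allI)
  fix b :: 'a assume b: "b \<in> Basis"
  have "negligible {x. x \<bullet> b = 0}"
    using negligible_standard_hyperplane[OF b, of 0] .
  moreover have "{x. x \<bullet> b = 0} \<in> sets lborel" by measurable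
  ultimately have "{x. x \<bullet> b = 0} \<in> null_sets lborel"
    by (simp add: negligible_iff_null_sets null_sets_completion_iff)
  from AE_not_in[OF this] show "AE x in lborel. x \<bullet> b \<noteq> 0" by simp
qed simp

text \<open>The lower bound for \<open>phi\<close> leaves the factor \<open>R\<close> to the power
  \<open>- N (1 - a)\<close>, where \<open>R = |W|^2\<close>. It is shared among the
  \<open>N - 1\<close> free coordinates, \<open>\<beta>\<close> for each. For a coordinate
  \<open>x + iy\<close>, the estimates \<open>x^2 + y^2 >= |x| |y|\<close>,
  \<open>R >= 1 + x^2\<close> and \<open>R >= 1 + y^2\<close> separate the real and imaginary
  parts.\<close>

lemma integrand_bound:
  fixes phi :: "('k::finite,'n::finite) hcoord \<Rightarrow> real" and W :: "('k,'n) hcoord"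
  defines "N \<equiv> real CARD('k \<times> 'n)"
  assumes phi: "smooth_proj phi" "admissible N phi" "G_invariant phi" "(SUP Z\<in>- {0}. phi Z) = 0"
    and a: "\<alpha> \<le> a" "0 \<le> a" "a < 1" and b: "0 \<le> \<beta>" "(N - 1) * \<beta> \<le> N * (1 - a)"
    and W: "W $ p0 = 1" "\<And>q. q \<noteq> p0 \<Longrightarrow> Re (W $ q) \<noteq> 0 \<and> Im (W $ q) \<noteq> 0"
  defines "h \<equiv> \<lambda>r :: real. \<bar>r\<bar> powr (- a) * (1 + r\<^sup>2) powr (- (\<beta> / 2))"
  shows "exp (- \<alpha> * phi W) / (norm W)\<^sup>2 ^ CARD('k \<times> 'n) \<le> (\<Prod>q\<in>- {p0}. h (Re (W $ q)) * h (Im (W $ q)))"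
proof -
  define R where "R = (norm W)\<^sup>2"
  have R_eq: "R = 1 + (\<Sum>q\<in>- {p0}. (cmod (W $ q))\<^sup>2)"
    using W(1) unfolding R_def norm_vec_power2
    by (subst sum.remove[of _ p0]) (auto simp: Compl_eq_Diff_UNIV)
  have R_ge: "1 + (cmod (W $ q))\<^sup>2 \<le> R" if "q \<noteq> p0" for q
    unfolding R_eq using that member_le_sum[of q "- {p0}" "\<lambda>q. (cmod (W $ q))\<^sup>2"] by simp
  have R1: "R \<ge> 1" unfolding R_eq by (simp add: sum_nonneg)
  define l where "l r = - a * ln \<bar>r\<bar> - \<beta> / 2 * ln (1 + r\<^sup>2)" for r :: real
  have h: "h r = exp (l r)" if "r \<noteq> 0" for r
    using that by (simp add: h_def l_def powr_def exp_add[symmetric] add_nonneg_eq_0_iff)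
  have W0: "W $ q \<noteq> 0" for q using W(1) W(2)[of q] by (cases "q = p0") (simp_all add: complex_eq_iff)
  have Wn: "W \<noteq> 0" using W0 by auto
  have le0: "phi W \<le> 0" using smooth_proj_le_SUP[OF phi(1) Wn] phi(4) by simp
  have low: "phi W \<ge> (\<Sum>q\<in>UNIV. ln ((cmod (W $ q))\<^sup>2)) - N * ln R"
    unfolding N_def R_def by (rule admissible_lower_bound) (use phi W0 in \<open>auto simp: N_def\<close>)
  have sum: "(\<Sum>q\<in>UNIV. ln ((cmod (W $ q))\<^sup>2)) = (\<Sum>q\<in>- {p0}. ln ((cmod (W $ q))\<^sup>2))"
    using W(1) by (subst sum.remove[of _ p0]) (auto simp: Compl_eq_Diff_UNIV)
  have cN: "real (card (- {p0})) = N - 1"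
    by (simp add: N_def Compl_eq_Diff_UNIV card_Diff_singleton of_nat_diff del: card_prod)
  \<comment> \<open>This uses \<open>phi W \<le> 0\<close> and allows a negative
    \<open>\<alpha>\<close> to be replaced by a nonnegative \<open>a\<close>.\<close>
  have "- \<alpha> * phi W \<le> - a * phi W"
    using a(1) le0 mult_right_mono_neg by fastforce
  also have "\<dots> \<le> - a * ((\<Sum>q\<in>- {p0}. ln ((cmod (W $ q))\<^sup>2)) - N * ln R)"
    using low a(2) unfolding sum by (simp add: mult_left_mono)
  finally have "- \<alpha> * phi W - N * ln R \<le> - a * (\<Sum>q\<in>- {p0}. ln ((cmod (W $ q))\<^sup>2)) - N * (1 - a) * ln R"
    by (simp add: algebra_simps)
  also have "\<dots> \<le> - a * (\<Sum>q\<in>- {p0}. ln ((cmod (W $ q))\<^sup>2)) - (N - 1) * \<beta> * ln R"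
    using b(2) R1 by (simp add: mult_right_mono)
  also have "\<dots> = (\<Sum>q\<in>- {p0}. - a * ln ((cmod (W $ q))\<^sup>2) - \<beta> * ln R)"
    by (simp add: sum_subtractf sum_distrib_left sum_negf flip: cN)
  also have "\<dots> \<le> (\<Sum>q\<in>- {p0}. l (Re (W $ q)) + l (Im (W $ q)))"
  proof (rule sum_mono)
    fix q assume "q \<in> - {p0}"
    then have q: "q \<noteq> p0" by simp
    define x y where "x = Re (W $ q)" and "y = Im (W $ q)"
    have xy: "x \<noteq> 0" "y \<noteq> 0" using W(2)[OF q] by (auto simp: x_def y_def)
    have z: "(cmod (W $ q))\<^sup>2 = x\<^sup>2 + y\<^sup>2" by (simp add: cmod_power2 x_def y_def)
    have "\<bar>x\<bar> * \<bar>y\<bar> \<le> x\<^sup>2 + y\<^sup>2"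
    proof -
      have "0 \<le> \<bar>x\<bar> * \<bar>y\<bar>" by simp
      moreover have "2 * (\<bar>x\<bar> * \<bar>y\<bar>) \<le> x\<^sup>2 + y\<^sup>2"
        using sum_squares_bound[of "\<bar>x\<bar>" "\<bar>y\<bar>"] by (simp add: mult.assoc)
      ultimately show ?thesis by linarith
    qed
    then have "ln (\<bar>x\<bar> * \<bar>y\<bar>) \<le> ln (x\<^sup>2 + y\<^sup>2)" using xy by (intro ln_mono) auto
    then have 1: "a * (ln \<bar>x\<bar> + ln \<bar>y\<bar>) \<le> a * ln (x\<^sup>2 + y\<^sup>2)"
      using a(2) xy by (intro mult_left_mono) (simp_all add: ln_mult)
    have "1 + x\<^sup>2 \<le> R" "1 + y\<^sup>2 \<le> R"
      using R_ge[OF q] unfolding z by (smt (verit) zero_le_power2)+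
    then have "ln (1 + x\<^sup>2) \<le> ln R" "ln (1 + y\<^sup>2) \<le> ln R"
      by (smt (verit) ln_le_cancel_iff zero_le_power2)+
    then have 2: "\<beta> / 2 * ln (1 + x\<^sup>2) \<le> \<beta> / 2 * ln R" "\<beta> / 2 * ln (1 + y\<^sup>2) \<le> \<beta> / 2 * ln R"
      using b(1) by (auto intro!: mult_left_mono)
    show "- a * ln ((cmod (W $ q))\<^sup>2) - \<beta> * ln R \<le> l (Re (W $ q)) + l (Im (W $ q))"
      using 1 2 unfolding l_def z x_def[symmetric] y_def[symmetric] by (simp add: algebra_simps)
  qed
  finally have "exp (- \<alpha> * phi W - N * ln R) \<le> exp (\<Sum>q\<in>- {p0}. l (Re (W $ q)) + l (Im (W $ q)))"
    by simp
  also have "\<dots> = (\<Prod>q\<in>- {p0}. h (Re (W $ q)) * h (Im (W $ q)))"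
    using W(2) by (simp add: exp_sum h exp_add)
  also have "exp (- \<alpha> * phi W - N * ln R) = exp (- \<alpha> * phi W) / R ^ CARD('k \<times> 'n)"
    using R1 by (simp add: exp_diff N_def exp_of_nat_mult del: card_prod)
  finally show ?thesis by (simp add: R_def)
qed

theorem theorem2:
  fixes p0 :: "'k::finite \<times> 'n::finite"
  assumes "\<alpha> < (1::real)"
  shows "\<exists>C::real. \<forall>phi :: ('k,'n) hcoord \<Rightarrow> real.
           smooth_proj phi
           \<and> admissible (real CARD('k \<times> 'n)) phi
           \<and> G_invariant phi
           \<and> (SUP Z\<in>- {0}. phi Z) = 0
           \<longrightarrow> vol_integral (real CARD('k \<times> 'n)) p0 (\<lambda>Z. exp (- \<alpha> * phi Z)) \<le> ennreal C"
proof -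
  define M where "M = CARD('k \<times> 'n)"
  define N where "N = real M"
  have N1: "N \<ge> 1" using zero_less_card_finite[where 'a = "'k \<times> 'n"] unfolding N_def M_def by linarith
  define a where "a = max \<alpha> 0"
  have a: "\<alpha> \<le> a" "0 \<le> a" "a < 1" using assms by (auto simp: a_def)
  \<comment> \<open>Both \<open>a + \<beta> > 1\<close> (decay at infinity) and \<open>(N - 1) \<beta> \<le> N (1 - a)\<close> hold for every \<open>N \<ge> 1\<close>.\<close>
  define \<beta> where "\<beta> = (1 - a) * (1 + 1 / N)"
  have \<beta>0: "\<beta> \<ge> 0" using a N1 by (simp add: \<beta>_def)
  have "(N - 1) * (1 + 1 / N) \<le> N" using N1 by (simp add: field_simps)
  then have \<beta>N: "(N - 1) * \<beta> \<le> N * (1 - a)"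
    using a(3) mult_right_mono[of "(N - 1) * (1 + 1 / N)" N "1 - a"] by (simp add: \<beta>_def mult_ac)
  have "a + \<beta> = 1 + (1 - a) / N" by (simp add: \<beta>_def algebra_simps)
  then have \<beta>1: "a + \<beta> > 1" using a N1 by simp
  define h where "h r = \<bar>r\<bar> powr (- a) * (1 + r\<^sup>2) powr (- (\<beta> / 2))" for r :: real
  \<comment> \<open>One factor per real coordinate: the two belonging to \<open>p0\<close> reproduce
    the unit square of the redundant coordinate, the others carry the bound
    \<open>h\<close>.\<close>
  define f :: "('k,'n) hcoord \<Rightarrow> real \<Rightarrow> ennreal" where
    "f b r = (if b \<in> {axis p0 1, axis p0 \<i>} then indicator {0..1} r else ennreal (h r))" for b r
  define K where "K = (\<Prod>b\<in>Basis. (\<integral>\<^sup>+ r. f b r \<partial>lborel))"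
  have f_meas [measurable]: "f b \<in> borel_measurable borel" for b
    unfolding f_def h_def by measurable
  have "(\<integral>\<^sup>+ r. f b r \<partial>lborel) < \<infinity>" for b
    using nn_integral_powr_finite[OF a(2,3) \<beta>0 \<beta>1]
    by (cases "b \<in> {axis p0 1, axis p0 \<i>}") (auto simp: f_def h_def)
  then have K: "K < \<infinity>" unfolding K_def by (auto simp: ennreal_prod_eq_top simp flip: less_top)
  define I where "I = {z. 0 \<le> Re z \<and> Re z \<le> 1 \<and> 0 \<le> Im z \<and> Im z \<le> 1}"
  \<comment> \<open>The constant does not involve \<open>phi\<close>. As \<open>K\<close> is finite,
    \<open>enn2real K\<close> retains its value.\<close>
  have "vol_integral N p0 (\<lambda>Z. exp (- \<alpha> * phi Z)) \<le> ennreal (N ^ (M - 1) * enn2real K)"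
    if phi: "smooth_proj phi" "admissible N phi" "G_invariant phi" "(SUP Z\<in>- {0}. phi Z) = 0"
    for phi :: "('k,'n) hcoord \<Rightarrow> real"
  proof -
    have "vol_integral N p0 (\<lambda>Z. exp (- \<alpha> * phi Z))
        \<le> (\<integral>\<^sup>+ Z. ennreal (N ^ (M - 1)) * (\<Prod>b\<in>Basis. f b (Z \<bullet> b)) \<partial>lborel)"
      unfolding vol_integral_def I_def[symmetric]
    proof (rule nn_integral_mono_AE, rule AE_mp[OF AE_inner_Basis_nonzero], rule AE_I2, rule impI)
      fix Z :: "('k,'n) hcoord" assume nz: "\<forall>b\<in>Basis. Z \<bullet> b \<noteq> 0"
      define W where "W = chart_pt p0 Z"
      have "axis q 1 \<in> (Basis :: ('k,'n) hcoord set)" "axis q \<i> \<in> (Basis :: ('k,'n) hcoord set)" for q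
        by (simp_all add: Basis_complex_def)
      then have nz': "Re (Z $ q) \<noteq> 0" "Im (Z $ q) \<noteq> 0" for q
        using nz by (metis inner_axis complex_inner_1_right, metis inner_axis complex_inner_i_right)
      have W: "W $ p0 = 1" "\<And>q. q \<noteq> p0 \<Longrightarrow> W $ q = Z $ q" by (simp_all add: W_def chart_pt_def)
      have h0: "h r \<ge> 0" for r by (simp add: h_def)
      have det: "Re (detS (- {p0}) (wirt2 (fs_pot N) W)) = N ^ (M - 1) / (norm W)\<^sup>2 ^ M"
        unfolding detS_fs_pot_chart[OF W(1)] by (simp add: M_def)
      have "exp (- \<alpha> * phi W) / (norm W)\<^sup>2 ^ M \<le> (\<Prod>q\<in>- {p0}. h (Re (W $ q)) * h (Im (W $ q)))"
        unfolding h_def M_def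
        by (rule integrand_bound[OF phi(1) _ phi(3,4) a \<beta>0])
           (use phi(2) \<beta>N W nz' in \<open>simp_all add: N_def M_def\<close>)
      also have "\<dots> = (\<Prod>q\<in>- {p0}. h (Re (Z $ q)) * h (Im (Z $ q)))"
        using W by (intro prod.cong) auto
      finally have "N ^ (M - 1) * indicator I (Z $ p0) * (exp (- \<alpha> * phi W) / (norm W)\<^sup>2 ^ M)
          \<le> N ^ (M - 1) * indicator I (Z $ p0) * (\<Prod>q\<in>- {p0}. h (Re (Z $ q)) * h (Im (Z $ q)))"
        using N1 by (intro mult_left_mono) auto
      then have "ennreal (indicator I (Z $ p0) * Re (detS (- {p0}) (wirt2 (fs_pot N) W)) * exp (- \<alpha> * phi W))
          \<le> ennreal (N ^ (M - 1) * (indicator I (Z $ p0) * (\<Prod>q\<in>- {p0}. h (Re (Z $ q)) * h (Im (Z $ q)))))"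
        unfolding det by (intro ennreal_leI) (simp add: mult_ac)
      also have "\<dots> = ennreal (N ^ (M - 1)) * (\<Prod>b\<in>Basis. f b (Z \<bullet> b))"
      proof -
        have "(\<Prod>b\<in>Basis. f b (Z \<bullet> b)) = (\<Prod>q\<in>UNIV. f (axis q 1) (Re (Z $ q)) * f (axis q \<i>) (Im (Z $ q)))"
          unfolding prod_Basis_complex_vec by (simp add: inner_axis)
        also have "\<dots> = (f (axis p0 1) (Re (Z $ p0)) * f (axis p0 \<i>) (Im (Z $ p0)))
            * (\<Prod>q\<in>- {p0}. f (axis q 1) (Re (Z $ q)) * f (axis q \<i>) (Im (Z $ q)))"
          by (subst prod.remove[of _ p0]) (auto simp: Compl_eq_Diff_UNIV)
        also have "f (axis p0 1) (Re (Z $ p0)) * f (axis p0 \<i>) (Im (Z $ p0)) = ennreal (indicator I (Z $ p0))"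
          by (simp add: f_def I_def indicator_def)
        also have "(\<Prod>q\<in>- {p0}. f (axis q 1) (Re (Z $ q)) * f (axis q \<i>) (Im (Z $ q)))
            = ennreal (\<Prod>q\<in>- {p0}. h (Re (Z $ q)) * h (Im (Z $ q)))"
          unfolding prod_ennreal[symmetric, OF mult_nonneg_nonneg[OF h0 h0]]
          by (intro prod.cong) (auto simp: f_def axis_eq_axis ennreal_mult h0)
        finally show ?thesis
          using N1 by (simp add: ennreal_mult h0 prod_nonneg)
      qed
      finally show "ennreal (indicator I (Z $ p0) * Re (detS (- {p0}) (wirt2 (fs_pot N) (chart_pt p0 Z)))
          * exp (- \<alpha> * phi (chart_pt p0 Z))) \<le> ennreal (N ^ (M - 1)) * (\<Prod>b\<in>Basis. f b (Z \<bullet> b))"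
        by (simp only: W_def)
    qed
    also have "\<dots> = ennreal (N ^ (M - 1)) * K"
      unfolding K_def by (subst nn_integral_cmult) (measurable, subst nn_integral_lborel_prod, auto)
    also have "\<dots> = ennreal (N ^ (M - 1) * enn2real K)"
      using K N1 by (simp add: ennreal_mult)
    finally show ?thesis .
  qed
  then show ?thesis unfolding N_def M_def by blast
qed

end
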